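(* Let $(\mathrm{X}, \varphi)$ be an invertible measure-preserving dynamical system with $h_\mu(\varphi) > 0$. Then $h_{\mathrm{apr}}(T_\varphi) = \infty$.
   Context: A measure-preserving dynamical system $(\mathrm{X},\varphi)$ consists of a probability space $\mathrm{X}=(X,\Sigma,\mu)$ and a $\Sigma$-measurable map $\varphi\colon X\to X$ with $\mu(\varphi^{-1}(A))=\mu(A)$ for all $A\in\Sigma$. It is invertible if there is a measure-preserving map $\varphi^{-1}\colon X\to X$ with $\varphi^{-1}\circ\varphi=\varphi\circ\varphi^{-1}=\mathrm{id}_X$ $\mu$-almost surely. The Koopman operator is $T_\varphi f=f\circ\varphi$ on $\mathrm{L}^2(\mathrm{X})$ (functions valued in $\mathbb{K}\in\{\mathbb{R},\mathbb{C}\}$); it is unitary when the system is invertible. Measure-theoretic entropy. For a finite $\Sigma$-measurable partition $\alpha$ of $X$, $H_\mu(\alpha):=\sum_{A\in\alpha}-\mu(A)\log\mu(A)$ (omitting null sets), $\alpha\vee\beta:=\{A\cap B:A\in\alpha,B\in\beta\}$, $\varphi^{-k}(\alpha):=\{\varphi^{-k}(A):A\in\alpha\}$, $h_\mu(\varphi,\alpha):=\lim_{n\to\infty}\frac1nH_\mu\bigl(\bigvee_{k=0}^{n-1}\varphi^{-k}(\alpha)\bigr)$, and $h_\mu(\varphi):=\sup_\alpha h_\mu(\varphi,\alpha)$ over all finite $\Sigma$-measurable partitions $\alpha$. Approximation entropy. Let $H$ be a Hilbert space and $T\colon H\to H$ unitary. For a finite set $\omega\subseteq H$ and $\delta>0$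 let $H_{\mathrm{apr}}(\omega,\delta)$ be the minimum of $\dim E$ over all finite-dimensional subspaces $E\subseteq H$ such that for every $x\in\omega$ there is $y\in E$ with $\lVert x-y\rVert<\delta$. Put $h_{\mathrm{apr}}(T,\omega,\delta):=\lim_{n\to\infty}\frac1n H_{\mathrm{apr}}\bigl(\bigcup_{k=0}^{n-1}T^k\omega,\delta\bigr)$ (the limit exists), $h_{\mathrm{apr}}(T,\omega):=\sup_{\delta>0}h_{\mathrm{apr}}(T,\omega,\delta)$, and $h_{\mathrm{apr}}(T):=\sup\{h_{\mathrm{apr}}(T,\omega):\omega\subseteq H\text{ finite}\}$. *)

theory Defs
  imports "HOL-Probability.Probability" "Jordan_Normal_Form.VS_Connect"
begin

section \<open>Measure-preserving systems and measure-theoretic entropy\<close>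

locale measure_preserving_system = prob_space M for M :: "'a measure" +
  fixes \<phi> :: "'a \<Rightarrow> 'a"
  assumes measurable_map: "\<phi> \<in> measurable M M"
    and measure_preserving: "\<And>A. A \<in> sets M \<Longrightarrow> measure M (\<phi> -` A \<inter> space M) = measure M A"

locale invertible_measure_preserving_system = measure_preserving_system +
  assumes invertible: "\<exists>\<psi>. measure_preserving_system M \<psi> \<and>
    (AE x in M. \<psi> (\<phi> x) = x) \<and> (AE x in M. \<phi> (\<psi> x) = x)"

definition measurable_partition :: "'a measure \<Rightarrow> 'a set set \<Rightarrow> bool" where
  "measurable_partition M \<alpha> \<longleftrightarrow> finite \<alpha> \<and> \<alpha> \<subseteq> sets M \<and> partition_on (space M) \<alpha>"

definition partition_entropy :: "'a measure \<Rightarrow> 'a set set \<Rightarrow> real" where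
  "partition_entropy M \<alpha> = (\<Sum>A\<in>{A\<in>\<alpha>. measure M A \<noteq> 0}. - measure M A * ln (measure M A))"

definition partition_join :: "'a set set \<Rightarrow> 'a set set \<Rightarrow> 'a set set" where
  "partition_join \<alpha> \<beta> = {A \<inter> B | A B. A \<in> \<alpha> \<and> B \<in> \<beta>}"

definition partition_vimage :: "'a measure \<Rightarrow> ('a \<Rightarrow> 'a) \<Rightarrow> 'a set set \<Rightarrow> 'a set set" where
  "partition_vimage M f \<alpha> = (\<lambda>A. f -` A \<inter> space M) ` \<alpha>"

text \<open>The iterated join of the \<open>\<phi>\<close>-preimages of \<open>\<alpha>\<close> under the powers \<open>k < n\<close>, the empty join
  being the trivial partition. Joins and preimages of partitions may contain the empty set; it
  does not contribute to the entropy.\<close>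

fun refined_partition :: "'a measure \<Rightarrow> ('a \<Rightarrow> 'a) \<Rightarrow> 'a set set \<Rightarrow> nat \<Rightarrow> 'a set set" where
  "refined_partition M \<phi> \<alpha> 0 = {space M}"
| "refined_partition M \<phi> \<alpha> (Suc n) =
     partition_join (refined_partition M \<phi> \<alpha> n) (partition_vimage M (\<phi> ^^ n) \<alpha>)"

definition entropy_of_partition :: "'a measure \<Rightarrow> ('a \<Rightarrow> 'a) \<Rightarrow> 'a set set \<Rightarrow> real" where
  "entropy_of_partition M \<phi> \<alpha> =
     lim (\<lambda>n. partition_entropy M (refined_partition M \<phi> \<alpha> n) / real n)"

definition measure_entropy :: "'a measure \<Rightarrow> ('a \<Rightarrow> 'a) \<Rightarrow> ereal" where
  "measure_entropy M \<phi> =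
     (SUP \<alpha>\<in>{\<alpha>. measurable_partition M \<alpha>}. ereal (entropy_of_partition M \<phi> \<alpha>))"


section \<open>Approximation entropy\<close>

text \<open>Since the \<open>L\<^sup>2\<close>-space depends on the measure, Hilbert spaces are represented by
  carrier-based vector spaces over the field \<^term>\<open>class_ring :: 'k::field ring\<close>, together with
  the norm. Approximation entropy only involves the linear structure and the norm.\<close>

record ('k, 'v) normed_module = "('k, 'v) module" + vnorm :: "'v \<Rightarrow> real"

definition approximates ::
    "('k::field, 'v, 'm) normed_module_scheme \<Rightarrow> 'v set \<Rightarrow> real \<Rightarrow> 'v set \<Rightarrow> bool" where
  "approximates H \<omega> \<delta> E \<longleftrightarrow> (\<forall>x\<in>\<omega>. \<exists>y\<in>E. vnorm H (x \<ominus>\<^bsub>H\<^esub> y) < \<delta>)"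

definition apr_dim ::
    "('k::field, 'v, 'm) normed_module_scheme \<Rightarrow> 'v set \<Rightarrow> real \<Rightarrow> nat" where
  "apr_dim H \<omega> \<delta> = (LEAST d. \<exists>E. VectorSpace.subspace class_ring E H \<and>
     vectorspace.fin_dim class_ring (H\<lparr>carrier := E\<rparr>) \<and>
     vectorspace.dim class_ring (H\<lparr>carrier := E\<rparr>) = d \<and>
     approximates H \<omega> \<delta> E)"

definition apr_entropy_at ::
    "('k::field, 'v, 'm) normed_module_scheme \<Rightarrow> ('v \<Rightarrow> 'v) \<Rightarrow> 'v set \<Rightarrow> real \<Rightarrow> real" where
  "apr_entropy_at H T \<omega> \<delta> = lim (\<lambda>n. real (apr_dim H (\<Union>k<n. (T ^^ k) ` \<omega>) \<delta>) / real n)"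

definition apr_entropy_of ::
    "('k::field, 'v, 'm) normed_module_scheme \<Rightarrow> ('v \<Rightarrow> 'v) \<Rightarrow> 'v set \<Rightarrow> ereal" where
  "apr_entropy_of H T \<omega> = (SUP \<delta>\<in>{0<..}. ereal (apr_entropy_at H T \<omega> \<delta>))"

definition apr_entropy ::
    "('k::field, 'v, 'm) normed_module_scheme \<Rightarrow> ('v \<Rightarrow> 'v) \<Rightarrow> ereal" where
  "apr_entropy H T = (SUP \<omega>\<in>{\<omega>. finite \<omega> \<and> \<omega> \<subseteq> carrier H}. apr_entropy_of H T \<omega>)"


section \<open>The \<open>L\<^sup>2\<close>-space and the Koopman operator\<close>

definition square_integrable :: "'a measure \<Rightarrow> ('a \<Rightarrow> 'k::real_normed_field) \<Rightarrow> bool" where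
  "square_integrable M f \<longleftrightarrow> f \<in> borel_measurable M \<and> integrable M (\<lambda>x. (norm (f x))\<^sup>2)"

definition L2_class :: "'a measure \<Rightarrow> ('a \<Rightarrow> 'k::real_normed_field) \<Rightarrow> ('a \<Rightarrow> 'k) set" where
  "L2_class M f = {g. square_integrable M g \<and> (AE x in M. f x = g x)}"

text \<open>The operations on almost-everywhere classes are defined through an arbitrary
  representative; the lemmas below show that they do not depend on it.\<close>

definition L2_rep :: "('a \<Rightarrow> 'k) set \<Rightarrow> 'a \<Rightarrow> 'k" where
  "L2_rep F = (SOME f. f \<in> F)"

definition L2 :: "'a measure \<Rightarrow> ('k::real_normed_field, ('a \<Rightarrow> 'k) set) normed_module" where
  "L2 M = \<lparr> carrier = {L2_class M f | f. square_integrable M f},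
     mult = undefined, one = undefined,
     zero = L2_class M (\<lambda>_. 0),
     add = (\<lambda>F G. L2_class M (\<lambda>x. L2_rep F x + L2_rep G x)),
     smult = (\<lambda>c F. L2_class M (\<lambda>x. c * L2_rep F x)),
     vnorm = (\<lambda>F. sqrt (LINT x|M. (norm (L2_rep F x))\<^sup>2)) \<rparr>"

definition koopman ::
    "'a measure \<Rightarrow> ('a \<Rightarrow> 'a) \<Rightarrow> ('a \<Rightarrow> 'k::real_normed_field) set \<Rightarrow> ('a \<Rightarrow> 'k) set" where
  "koopman M \<phi> F = L2_class M (L2_rep F \<circ> \<phi>)"


lemma square_integrable_add:
  fixes f g :: "'a \<Rightarrow> 'k::{real_normed_field, second_countable_topology}"
  assumes "square_integrable M f" "square_integrable M g"
  shows "square_integrable M (\<lambda>x. f x + g x)"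
proof -
  have [measurable]: "f \<in> borel_measurable M" "g \<in> borel_measurable M"
    using assms by (auto simp: square_integrable_def)
  have "integrable M (\<lambda>x. (norm (f x + g x))\<^sup>2)"
  proof (rule Bochner_Integration.integrable_bound)
    show "integrable M (\<lambda>x. 2 * (norm (f x))\<^sup>2 + 2 * (norm (g x))\<^sup>2)"
      using assms by (auto simp: square_integrable_def)
    have "(norm (f x + g x))\<^sup>2 \<le> 2 * (norm (f x))\<^sup>2 + 2 * (norm (g x))\<^sup>2" for x
    proof -
      have "(norm (f x + g x))\<^sup>2 \<le> (norm (f x) + norm (g x))\<^sup>2"
        by (simp add: norm_triangle_ineq power_mono)
      also have "\<dots> \<le> 2 * (norm (f x))\<^sup>2 + 2 * (norm (g x))\<^sup>2"
        using sum_squares_ge_zero[of "norm (f x) - norm (g x)" 0]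
        by (simp add: power2_eq_square algebra_simps)
      finally show ?thesis .
    qed
    then show "AE x in M. norm ((norm (f x + g x))\<^sup>2) \<le> norm (2 * (norm (f x))\<^sup>2 + 2 * (norm (g x))\<^sup>2)"
      by (auto simp: abs_of_nonneg)
  qed measurable
  then show ?thesis by (simp add: square_integrable_def)
qed

lemma square_integrable_mult:
  fixes f :: "'a \<Rightarrow> 'k::{real_normed_field, second_countable_topology}"
  assumes "square_integrable M f"
  shows "square_integrable M (\<lambda>x. c * f x)"
  using assms by (auto simp: square_integrable_def norm_mult power_mult_distrib)

lemma square_integrable_zero: "square_integrable M (\<lambda>_. 0)"
  by (simp add: square_integrable_def)

lemma L2_class_eq_iff:
  assumes "square_integrable M f" "square_integrable M g"
  shows "L2_class M f = L2_class M g \<longleftrightarrow> (AE x in M. f x = g x)"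
proof
  assume "L2_class M f = L2_class M g"
  moreover have "g \<in> L2_class M g" using assms by (simp add: L2_class_def)
  ultimately show "AE x in M. f x = g x" by (auto simp: L2_class_def)
next
  assume *: "AE x in M. f x = g x"
  have "(AE x in M. f x = h x) \<longleftrightarrow> (AE x in M. g x = h x)" for h
    using * by (intro iffI) (auto elim: AE_mp)
  then show "L2_class M f = L2_class M g" by (auto simp: L2_class_def)
qed

lemma L2_rep_class:
  assumes "square_integrable M f"
  shows "square_integrable M (L2_rep (L2_class M f))" "AE x in M. f x = L2_rep (L2_class M f) x"
proof -
  have "f \<in> L2_class M f" using assms by (simp add: L2_class_def)
  then have "L2_rep (L2_class M f) \<in> L2_class M f" unfolding L2_rep_def
    by (rule someI[of "\<lambda>g. g \<in> L2_class M f"])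
  then show "square_integrable M (L2_rep (L2_class M f))" "AE x in M. f x = L2_rep (L2_class M f) x"
    by (auto simp: L2_class_def)
qed

lemma add_L2_class:
  fixes f g :: "'a \<Rightarrow> 'k::{real_normed_field, second_countable_topology}"
  assumes f: "square_integrable M f" and g: "square_integrable M g"
  shows "L2_class M f \<oplus>\<^bsub>L2 M\<^esub> L2_class M g = L2_class M (\<lambda>x. f x + g x)"
proof -
  have "AE x in M. L2_rep (L2_class M f) x + L2_rep (L2_class M g) x = f x + g x"
    using L2_rep_class(2)[OF f] L2_rep_class(2)[OF g] by eventually_elim simp
  then have "L2_class M (\<lambda>x. L2_rep (L2_class M f) x + L2_rep (L2_class M g) x) = L2_class M (\<lambda>x. f x + g x)"
    by (intro iffD2[OF L2_class_eq_iff] square_integrable_add L2_rep_class(1) f g)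
  then show ?thesis by (simp add: L2_def)
qed

lemma smult_L2_class:
  fixes f :: "'a \<Rightarrow> 'k::{real_normed_field, second_countable_topology}"
  assumes f: "square_integrable M f"
  shows "c \<odot>\<^bsub>L2 M\<^esub> L2_class M f = L2_class M (\<lambda>x. c * f x)"
proof -
  have "AE x in M. c * L2_rep (L2_class M f) x = c * f x"
    using L2_rep_class(2)[OF f] by eventually_elim simp
  then have "L2_class M (\<lambda>x. c * L2_rep (L2_class M f) x) = L2_class M (\<lambda>x. c * f x)"
    by (intro iffD2[OF L2_class_eq_iff] square_integrable_mult L2_rep_class(1) f)
  then show ?thesis by (simp add: L2_def)
qed

lemma vnorm_L2_class:
  fixes f :: "'a \<Rightarrow> 'k::{real_normed_field, second_countable_topology}"
  assumes f: "square_integrable M f"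
  shows "vnorm (L2 M) (L2_class M f) = sqrt (LINT x|M. (norm (f x))\<^sup>2)"
proof -
  have [measurable]: "f \<in> borel_measurable M" "L2_rep (L2_class M f) \<in> borel_measurable M"
    using f L2_rep_class(1)[OF f] by (auto simp: square_integrable_def)
  have "AE x in M. (norm (L2_rep (L2_class M f) x))\<^sup>2 = (norm (f x))\<^sup>2"
    using L2_rep_class(2)[OF f] by eventually_elim simp
  then have "(LINT x|M. (norm (L2_rep (L2_class M f) x))\<^sup>2) = (LINT x|M. (norm (f x))\<^sup>2)"
    by (intro integral_cong_AE) auto
  then show ?thesis by (simp add: L2_def)
qed

lemma (in measure_preserving_system) distr_map: "distr M M \<phi> = M"
proof (rule measure_eqI)
  show "emeasure (distr M M \<phi>) A = emeasure M A" if "A \<in> sets (distr M M \<phi>)" for A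
    using that measurable_map measure_preserving[of A]
    by (simp add: emeasure_distr emeasure_eq_measure)
qed simp

lemma (in measure_preserving_system) square_integrable_comp:
  fixes f :: "'a \<Rightarrow> 'k::{real_normed_field, second_countable_topology}"
  assumes "square_integrable M f"
  shows "square_integrable M (f \<circ> \<phi>)"
proof -
  have [measurable]: "f \<in> borel_measurable M" using assms by (simp add: square_integrable_def)
  have "integrable (distr M M \<phi>) (\<lambda>x. (norm (f x))\<^sup>2)"
    using assms by (simp add: distr_map square_integrable_def)
  then have "integrable M (\<lambda>x. (norm (f (\<phi> x)))\<^sup>2)"
    using measurable_map by (subst (asm) integrable_distr_eq) auto
  then show ?thesis
    using measurable_comp[OF measurable_map, of f borel] by (simp add: square_integrable_def)
qed

lemma (in measure_preserving_system) koopman_L2_class: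
  fixes f :: "'a \<Rightarrow> 'k::{real_normed_field, second_countable_topology}"
  assumes f: "square_integrable M f"
  shows "koopman M \<phi> (L2_class M f) = L2_class M (f \<circ> \<phi>)"
proof -
  have "AE x in distr M M \<phi>. f x = L2_rep (L2_class M f) x"
    unfolding distr_map by (rule L2_rep_class(2)[OF f])
  then have "AE x in M. f (\<phi> x) = L2_rep (L2_class M f) (\<phi> x)"
    by (rule AE_distrD[OF measurable_map])
  then have "AE x in M. (L2_rep (L2_class M f) \<circ> \<phi>) x = (f \<circ> \<phi>) x"
    by eventually_elim simp
  then show ?thesis
    unfolding koopman_def
    using square_integrable_comp[OF f] square_integrable_comp[OF L2_rep_class(1)[OF f]]
    by (simp only: L2_class_eq_iff)
qed

lemma carrier_L2: "carrier (L2 M) = {L2_class M f | f. square_integrable M f}"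
  by (simp add: L2_def)

lemma zero_L2: "\<zero>\<^bsub>L2 M\<^esub> = L2_class M (\<lambda>_. 0)"
  by (simp add: L2_def)

lemma vectorspace_L2:
  "vectorspace class_ring
     (L2 M :: ('k::{real_normed_field, second_countable_topology}, ('a \<Rightarrow> 'k) set) normed_module)"
proof (rule vs_criteria)
  let ?V = "L2 M :: ('k, ('a \<Rightarrow> 'k) set) normed_module"
  show "field (class_ring :: 'k ring)" by (rule class_field.field_axioms)
  show "\<zero>\<^bsub>?V\<^esub> \<in> carrier ?V"
    using square_integrable_zero by (auto simp: carrier_L2 zero_L2)
  show "\<forall>v\<in>carrier ?V. \<exists>w\<in>carrier ?V. v \<oplus>\<^bsub>?V\<^esub> w = \<zero>\<^bsub>?V\<^esub>"
  proof
    fix v assume "v \<in> carrier ?V"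
    then obtain f where f: "square_integrable M f" "v = L2_class M f" by (auto simp: carrier_L2)
    have m: "square_integrable M (\<lambda>x. - 1 * f x)" by (rule square_integrable_mult[OF f(1)])
    then have "v \<oplus>\<^bsub>?V\<^esub> L2_class M (\<lambda>x. - 1 * f x) = \<zero>\<^bsub>?V\<^esub>"
      using f by (simp add: add_L2_class zero_L2)
    with m show "\<exists>w\<in>carrier ?V. v \<oplus>\<^bsub>?V\<^esub> w = \<zero>\<^bsub>?V\<^esub>" by (auto simp: carrier_L2)
  qed
qed (auto simp: carrier_L2 zero_L2 add_L2_class smult_L2_class square_integrable_add
  square_integrable_mult square_integrable_zero algebra_simps)

end

theory Submission
  imports Defs
begin

text \<open>Let \<open>\<alpha>\<close> be a partition with positive entropy, \<open>F\<close> the \<open>\<sigma>\<close>-algebra generated by all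
  \<open>\<phi>\<^sup>-\<^sup>k \<alpha>\<close>, \<open>k \<ge> 0\<close>, and \<open>P = \<phi>\<inverse> F\<close>. If every \<open>A \<in> \<alpha>\<close> were almost surely in \<open>P\<close>, the increments
  of the entropies of the refined partitions would tend to \<open>0\<close>; so for some \<open>A\<close> the innovation
  \<open>f = 1\<^sub>A - E(1\<^sub>A | P)\<close> is not \<open>0\<close>. Any \<open>e = f 1\<^sub>B\<close> with \<open>B \<in> P\<close> is \<open>F\<close>-measurable and orthogonal to
  \<open>L\<^sup>2(P)\<close>, so its orbit under the Koopman operator is orthogonal. The measure \<open>f\<^sup>2 \<mu>\<close> has no atoms
  on \<open>P\<close>: a point of positive mass in the one-sided symbolic system is periodic, hence its past
  is determined. So for every \<open>K\<close> there are \<open>K\<close> disjoint sets \<open>B\<close>, giving \<open>K\<close> vectors whose first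
  \<open>n\<close> iterates form \<open>n K\<close> orthonormal vectors. By Bessel's inequality a subspace at distance less
  than \<open>\<delta>\<close> from all of them has dimension at least \<open>(1 - \<delta>\<^sup>2) n K\<close>.\<close>

section \<open>Orthonormal families and approximating subspaces\<close>

text \<open>One vector spans at most \<open>n\<close> dimensions within \<open>n\<close> steps, so a
  single orthonormal orbit bounds the entropy only by a constant, at any tolerance. Infinity has to
  come from multiplicity, and cutting the innovation by past sets provides it: a cut keeps both
  properties on which the orthogonality of the orbit rests. That arbitrarily many disjoint cuts
  leave nonzero pieces is what the absence of atoms is for.

  The probability space is arbitrary, so neither points of the symbolic factor nor conditional
  measures are at hand. Atoms are therefore sets which no past set splits, and the periodic point is
  replaced by a set that agrees with one of its preimages up to a null set, which recurrence
  supplies.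

  The innovations are real-valued. For other scalars the approximating space is broken into real
  components, at the price of the factor \<open>DIM('k)\<close>, harmless when \<open>K\<close> is
  unbounded.

  \<open>lim\<close> and \<open>LEAST\<close> denote the intended numbers only where a limit and an
  admissible dimension exist. This is why a lower bound also needs subadditivity and the existence
  of approximating subspaces.\<close>

definition orthonormal_family :: "'a measure \<Rightarrow> 'i set \<Rightarrow> ('i \<Rightarrow> 'a \<Rightarrow> real) \<Rightarrow> bool" where
  "orthonormal_family M I u \<longleftrightarrow> (\<forall>i\<in>I. square_integrable M (u i)) \<and>
     (\<forall>i\<in>I. \<forall>j\<in>I. (LINT x|M. u i x * u j x) = (if i = j then 1 else 0))"

lemma integrable_mult_square_integrable:
  fixes f g :: "'a \<Rightarrow> real"
  assumes "square_integrable M f" "square_integrable M g"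
  shows "integrable M (\<lambda>x. f x * g x)"
proof (rule Bochner_Integration.integrable_bound)
  show "integrable M (\<lambda>x. (f x)\<^sup>2 + (g x)\<^sup>2)"
    using assms by (auto simp: square_integrable_def)
  show "(\<lambda>x. f x * g x) \<in> borel_measurable M"
    using assms by (auto simp: square_integrable_def)
  have "\<bar>f x * g x\<bar> \<le> (f x)\<^sup>2 + (g x)\<^sup>2" for x
  proof -
    have "2 * \<bar>f x * g x\<bar> \<le> (f x)\<^sup>2 + (g x)\<^sup>2"
      using sum_squares_bound[of "\<bar>f x\<bar>" "\<bar>g x\<bar>"] by (simp add: abs_mult)
    then show ?thesis by linarith
  qed
  then show "AE x in M. norm (f x * g x) \<le> norm ((f x)\<^sup>2 + (g x)\<^sup>2)"
    by (simp add: abs_of_nonneg)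
qed

lemma square_integrable_sum:
  fixes f :: "'i \<Rightarrow> 'a \<Rightarrow> 'k::{real_normed_field, second_countable_topology}"
  assumes "\<And>i. i \<in> I \<Longrightarrow> square_integrable M (f i)"
  shows "square_integrable M (\<lambda>x. \<Sum>i\<in>I. c i * f i x)"
  using assms
proof (induction I rule: infinite_finite_induct)
  case (insert i I)
  then show ?case by (simp add: square_integrable_add square_integrable_mult)
qed (simp_all add: square_integrable_zero)

lemma square_integrable_diff:
  fixes f g :: "'a \<Rightarrow> 'k::{real_normed_field, second_countable_topology}"
  assumes "square_integrable M f" "square_integrable M g"
  shows "square_integrable M (\<lambda>x. f x - g x)"
  using square_integrable_add[OF assms(1) square_integrable_mult[OF assms(2), of "-1"]] by simp

text \<open>The coefficients are left free: Bessel's inequality takes the Fourier coefficients, the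
  dimension count the unknown ones of an approximant.\<close>

lemma integral_sq_diff_orthonormal:
  fixes f :: "'a \<Rightarrow> real"
  assumes fin: "finite I" and orth: "orthonormal_family M I u" and f: "square_integrable M f"
  shows "(LINT x|M. (f x - (\<Sum>i\<in>I. a i * u i x))\<^sup>2) =
    (LINT x|M. (f x)\<^sup>2) - 2 * (\<Sum>i\<in>I. a i * (LINT x|M. f x * u i x)) + (\<Sum>i\<in>I. (a i)\<^sup>2)"
proof -
  have sq: "square_integrable M (u i)" if "i \<in> I" for i
    using orth that by (simp add: orthonormal_family_def)
  have i1: "integrable M (\<lambda>x. (f x)\<^sup>2)"
    using integrable_mult_square_integrable[OF f f] by (simp add: power2_eq_square)
  have i2: "integrable M (\<lambda>x. a i * (f x * u i x))" if "i \<in> I" for i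
    using integrable_mult_square_integrable[OF f sq[OF that]] by simp
  have i3: "integrable M (\<lambda>x. a i * a j * (u i x * u j x))" if "i \<in> I" "j \<in> I" for i j
    using integrable_mult_square_integrable[OF sq[OF that(1)] sq[OF that(2)]] by simp
  have "(f x - (\<Sum>i\<in>I. a i * u i x))\<^sup>2 =
      (f x)\<^sup>2 - 2 * (\<Sum>i\<in>I. a i * (f x * u i x)) + (\<Sum>i\<in>I. \<Sum>j\<in>I. a i * a j * (u i x * u j x))" for x
  proof -
    have "(\<Sum>i\<in>I. a i * u i x)\<^sup>2 = (\<Sum>i\<in>I. \<Sum>j\<in>I. a i * a j * (u i x * u j x))"
      by (simp add: power2_eq_square sum_product mult_ac)
    moreover have "f x * (\<Sum>i\<in>I. a i * u i x) = (\<Sum>i\<in>I. a i * (f x * u i x))"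
      by (simp add: sum_distrib_left mult_ac)
    ultimately show ?thesis by (simp add: power2_diff)
  qed
  then have "(LINT x|M. (f x - (\<Sum>i\<in>I. a i * u i x))\<^sup>2) =
     (LINT x|M. (f x)\<^sup>2 - 2 * (\<Sum>i\<in>I. a i * (f x * u i x)) + (\<Sum>i\<in>I. \<Sum>j\<in>I. a i * a j * (u i x * u j x)))"
    by simp
  also have "\<dots> = (LINT x|M. (f x)\<^sup>2) - 2 * (\<Sum>i\<in>I. LINT x|M. a i * (f x * u i x)) +
      (\<Sum>i\<in>I. \<Sum>j\<in>I. LINT x|M. a i * a j * (u i x * u j x))"
    using i1 i2 i3 by (simp add: Bochner_Integration.integral_sum)
  also have "(\<Sum>i\<in>I. \<Sum>j\<in>I. LINT x|M. a i * a j * (u i x * u j x)) = (\<Sum>i\<in>I. \<Sum>j\<in>I. if i = j then a i * a j else 0)"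
    using orth by (intro sum.cong refl) (simp add: orthonormal_family_def)
  also have "\<dots> = (\<Sum>i\<in>I. (a i)\<^sup>2)"
    using fin by (simp add: power2_eq_square)
  finally show ?thesis by simp
qed

lemma bessel_inequality:
  fixes f :: "'a \<Rightarrow> real"
  assumes "finite I" "orthonormal_family M I u" "square_integrable M f"
  shows "(\<Sum>i\<in>I. (LINT x|M. f x * u i x)\<^sup>2) \<le> (LINT x|M. (f x)\<^sup>2)"
proof -
  have "0 \<le> (LINT x|M. (f x - (\<Sum>i\<in>I. (LINT y|M. f y * u i y) * u i x))\<^sup>2)" by simp
  also have "\<dots> = (LINT x|M. (f x)\<^sup>2) - (\<Sum>i\<in>I. (LINT x|M. f x * u i x)\<^sup>2)"
    by (subst integral_sq_diff_orthonormal[OF assms]) (simp add: power2_eq_square)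
  finally show ?thesis by simp
qed

text \<open>Functions and almost-everywhere identities avoid the passage to classes. The residual of
  a new function after projection is either null, and nothing is added, or it is normalised and
  added; so \<open>B\<close> never outgrows \<open>I\<close>.\<close>

lemma gram_schmidt_functions:
  fixes b :: "'i \<Rightarrow> 'a \<Rightarrow> real"
  assumes "finite I" "\<And>i. i \<in> I \<Longrightarrow> square_integrable M (b i)"
  shows "\<exists>B. finite B \<and> card B \<le> card I \<and> orthonormal_family M B (\<lambda>g. g) \<and>
    (\<forall>i\<in>I. \<exists>a. AE x in M. b i x = (\<Sum>g\<in>B. a g * g x))"
  using assms
proof (induction I)
  case empty
  then show ?case by (intro exI[of _ "{}"]) (simp add: orthonormal_family_def)
next
  case (insert k I)
  then obtain B where B: "finite B" "card B \<le> card I" "orthonormal_family M B (\<lambda>g. g)"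
    and span: "\<forall>i\<in>I. \<exists>a. AE x in M. b i x = (\<Sum>g\<in>B. a g * g x)" by auto
  have sqB: "square_integrable M g" if "g \<in> B" for g
    using B(3) that by (simp add: orthonormal_family_def)
  have sqk: "square_integrable M (b k)" using insert by simp
  define a where "a g = (LINT x|M. b k x * g x)" for g
  define w where "w x = b k x - (\<Sum>g\<in>B. a g * g x)" for x
  have sqw: "square_integrable M w"
    unfolding w_def[abs_def] by (intro square_integrable_diff sqk square_integrable_sum sqB)
  have wB: "(LINT x|M. w x * h x) = 0" if "h \<in> B" for h
  proof -
    have "(LINT x|M. w x * h x) = (LINT x|M. b k x * h x - (\<Sum>g\<in>B. a g * (g x * h x)))"
      unfolding w_def by (simp add: left_diff_distrib sum_distrib_right mult.assoc)
    also have "\<dots> = (LINT x|M. b k x * h x) - (\<Sum>g\<in>B. a g * (LINT x|M. g x * h x))"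
      using integrable_mult_square_integrable[OF sqk sqB[OF that]]
        integrable_mult_square_integrable[OF sqB sqB[OF that]] 
      by (simp add: Bochner_Integration.integral_sum)
    also have "(\<Sum>g\<in>B. a g * (LINT x|M. g x * h x)) = (\<Sum>g\<in>B. if g = h then a g else 0)"
      using B(3) that by (intro sum.cong) (simp_all add: orthonormal_family_def)
    finally show ?thesis using B(1) that by (simp add: a_def)
  qed
  have intw: "integrable M (\<lambda>x. (w x)\<^sup>2)" using sqw by (simp add: square_integrable_def)
  show ?case
  proof (cases "(LINT x|M. (w x)\<^sup>2) = 0")
    case True
    then have "AE x in M. w x = 0"
      using integral_nonneg_eq_0_iff_AE[OF intw] by simp
    then have "AE x in M. b k x = (\<Sum>g\<in>B. a g * g x)" by eventually_elim (simp add: w_def)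
    then show ?thesis using B span insert.hyps by (intro exI[of _ B]) auto
  next
    case False
    define c where "c = sqrt (LINT x|M. (w x)\<^sup>2)"
    have c: "c > 0" "c\<^sup>2 = (LINT x|M. (w x)\<^sup>2)"
      using False by (simp_all add: c_def less_le)
    define v where "v x = (1 / c) * w x" for x
    have sqv: "square_integrable M v" unfolding v_def[abs_def] by (intro square_integrable_mult sqw)
    have vB: "(LINT x|M. v x * h x) = 0" "(LINT x|M. h x * v x) = 0" if "h \<in> B" for h
      using wB[OF that] by (simp_all add: v_def mult_ac)
    have vv: "(LINT x|M. v x * v x) = 1"
      using False by (simp add: v_def power2_eq_square[symmetric] power_divide c(2))
    \<comment> \<open>A member of \<open>B\<close> would be orthogonal to itself, against norm
      1.\<close>
    have "v \<notin> B"
      using vB(1)[of v] vv by auto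
    have "orthonormal_family M (insert v B) (\<lambda>g. g)"
      using B(3) sqv vB vv \<open>v \<notin> B\<close> by (auto simp: orthonormal_family_def)
    moreover have "\<exists>a. AE x in M. b i x = (\<Sum>g\<in>insert v B. a g * g x)" if "i \<in> insert k I" for i
    proof (cases "i = k")
      case True
      have "b k x = (\<Sum>g\<in>insert v B. (a(v := c)) g * g x)" for x
      proof -
        have "(\<Sum>g\<in>B. (a(v := c)) g * g x) = (\<Sum>g\<in>B. a g * g x)"
          using \<open>v \<notin> B\<close> by (intro sum.cong) auto
        then show ?thesis using B(1) \<open>v \<notin> B\<close> c by (simp add: v_def w_def)
      qed
      then show ?thesis using True by (intro exI[of _ "a(v := c)"]) simp
    next
      case False
      then obtain a' where a': "AE x in M. b i x = (\<Sum>g\<in>B. a' g * g x)" using span \<open>i \<in> insert k I\<close> by blast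
      have "(\<Sum>g\<in>insert v B. (a'(v := 0)) g * g x) = (\<Sum>g\<in>B. a' g * g x)" for x
      proof -
        have "(\<Sum>g\<in>B. (a'(v := 0)) g * g x) = (\<Sum>g\<in>B. a' g * g x)"
          using \<open>v \<notin> B\<close> by (intro sum.cong) auto
        then show ?thesis using B(1) \<open>v \<notin> B\<close> by simp
      qed
      then show ?thesis using a' by (intro exI[of _ "a'(v := 0)"]) simp
    qed
    ultimately show ?thesis
      using B insert.hyps \<open>v \<notin> B\<close> by (intro exI[of _ "insert v B"]) simp
  qed
qed

text \<open>The squared inner products of the \<open>u j\<close> with an orthonormal basis
  \<open>B\<close> of the span are counted in two ways. Summed over \<open>B\<close> they give the
  squared norm of the projection of \<open>u j\<close>, at least \<open>1 - \<epsilon>\<close>;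
  summed over \<open>J\<close> they are at most 1 for each element of \<open>B\<close>, by
  Bessel.\<close>

lemma orthonormal_approximation_card:
  fixes u :: "'j \<Rightarrow> 'a \<Rightarrow> real" and b :: "'i \<Rightarrow> 'a \<Rightarrow> real"
  assumes J: "finite J" "orthonormal_family M J u"
    and I: "finite I" "\<And>i. i \<in> I \<Longrightarrow> square_integrable M (b i)"
    and approx: "\<And>j. j \<in> J \<Longrightarrow> \<exists>c. (LINT x|M. (u j x - (\<Sum>i\<in>I. c i * b i x))\<^sup>2) \<le> \<epsilon>"
  shows "(1 - \<epsilon>) * card J \<le> card I"
proof -
  have "\<exists>B. finite B \<and> card B \<le> card I \<and> orthonormal_family M B (\<lambda>g. g) \<and>
      (\<forall>i\<in>I. \<exists>a. AE x in M. b i x = (\<Sum>g\<in>B. a g * g x))"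
    by (rule gram_schmidt_functions[OF I])
  then obtain B where B: "finite B" "card B \<le> card I" "orthonormal_family M B (\<lambda>g. g)"
    and span: "\<forall>i\<in>I. \<exists>a. AE x in M. b i x = (\<Sum>g\<in>B. a g * g x)"
    by (elim exE conjE)
  have sqB: "square_integrable M g" if "g \<in> B" for g
    using B(3) that by (simp add: orthonormal_family_def)
  have sqJ: "square_integrable M (u j)" if "j \<in> J" for j
    using J(2) that by (simp add: orthonormal_family_def)
  obtain a where a: "\<forall>i\<in>I. AE x in M. b i x = (\<Sum>g\<in>B. a i g * g x)"
    using bchoice[OF span] by (elim exE)
  have ge: "1 - \<epsilon> \<le> (\<Sum>g\<in>B. (LINT x|M. u j x * g x)\<^sup>2)" if j: "j \<in> J" for j
  proof -
    obtain c where c: "(LINT x|M. (u j x - (\<Sum>i\<in>I. c i * b i x))\<^sup>2) \<le> \<epsilon>" using approx[OF j] by blast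
    define e where "e g = (\<Sum>i\<in>I. c i * a i g)" for g
    have "AE x in M. \<forall>i\<in>I. b i x = (\<Sum>g\<in>B. a i g * g x)"
      using I(1) a by (intro AE_finite_allI) auto
    then have *: "AE x in M. (\<Sum>i\<in>I. c i * b i x) = (\<Sum>g\<in>B. e g * g x)"
    proof eventually_elim
      case (elim x)
      then have "(\<Sum>i\<in>I. c i * b i x) = (\<Sum>i\<in>I. \<Sum>g\<in>B. c i * (a i g * g x))"
        by (simp add: sum_distrib_left)
      also have "\<dots> = (\<Sum>g\<in>B. \<Sum>i\<in>I. c i * (a i g * g x))" by (rule sum.swap)
      finally show ?case by (simp add: e_def sum_distrib_right mult.assoc)
    qed
    have [measurable]: "u j \<in> borel_measurable M" "\<And>g. g \<in> B \<Longrightarrow> g \<in> borel_measurable M"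
      "\<And>i. i \<in> I \<Longrightarrow> b i \<in> borel_measurable M"
      using sqJ[OF j] sqB I(2) by (auto simp: square_integrable_def)
    have "(LINT x|M. (u j x - (\<Sum>i\<in>I. c i * b i x))\<^sup>2) = (LINT x|M. (u j x - (\<Sum>g\<in>B. e g * g x))\<^sup>2)"
      using * by (intro integral_cong_AE) auto
    also have "\<dots> = (LINT x|M. (u j x)\<^sup>2) - 2 * (\<Sum>g\<in>B. e g * (LINT x|M. u j x * g x)) + (\<Sum>g\<in>B. (e g)\<^sup>2)"
      by (rule integral_sq_diff_orthonormal[OF B(1,3) sqJ[OF j]])
    also have "(LINT x|M. (u j x)\<^sup>2) = 1"
      using J(2) j by (simp add: orthonormal_family_def power2_eq_square)
    finally have "1 - \<epsilon> \<le> (\<Sum>g\<in>B. 2 * (e g * (LINT x|M. u j x * g x)) - (e g)\<^sup>2)"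
      using c by (simp add: sum_subtractf sum_distrib_left)
    \<comment> \<open>No coefficient does better than the Fourier coefficient: complete the square
      in each term.\<close>
    also have "\<dots> \<le> (\<Sum>g\<in>B. (LINT x|M. u j x * g x)\<^sup>2)"
    proof (rule sum_mono)
      fix g
      have "0 \<le> (e g - (LINT x|M. u j x * g x))\<^sup>2" by simp
      then show "2 * (e g * (LINT x|M. u j x * g x)) - (e g)\<^sup>2 \<le> (LINT x|M. u j x * g x)\<^sup>2"
        by (simp add: power2_diff)
    qed
    finally show ?thesis .
  qed
  have "(1 - \<epsilon>) * card J = (\<Sum>j\<in>J. 1 - \<epsilon>)" by simp
  also have "\<dots> \<le> (\<Sum>j\<in>J. \<Sum>g\<in>B. (LINT x|M. u j x * g x)\<^sup>2)" by (intro sum_mono ge)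
  also have "\<dots> = (\<Sum>g\<in>B. \<Sum>j\<in>J. (LINT x|M. g x * u j x)\<^sup>2)"
    by (subst sum.swap) (simp add: mult.commute)
  also have "\<dots> \<le> (\<Sum>g\<in>B. LINT x|M. (g x)\<^sup>2)"
    by (intro sum_mono bessel_inequality J sqB)
  also have "\<dots> = card B"
    using B(3) by (simp add: orthonormal_family_def power2_eq_square)
  finally show ?thesis using B(2) by linarith
qed

lemma orthonormal_approximation_dim:
  fixes u :: "'j \<Rightarrow> 'a \<Rightarrow> real" and b :: "'i \<Rightarrow> 'a \<Rightarrow> 'k::{real_normed_field, euclidean_space}"
  assumes J: "finite J" "orthonormal_family M J u"
    and I: "finite I" "\<And>i. i \<in> I \<Longrightarrow> square_integrable M (b i)"
    and approx: "\<And>j. j \<in> J \<Longrightarrow>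
      \<exists>c. (LINT x|M. (norm (of_real (u j x) - (\<Sum>i\<in>I. c i * b i x)))\<^sup>2) \<le> \<epsilon>"
  shows "(1 - \<epsilon>) * card J \<le> card I * DIM('k)"
proof -
  txt \<open>Replacing the \<open>b i\<close> by their real components multiplies their number by \<open>DIM('k)\<close>; the
  component of \<open>c i * b i x\<close> along \<open>1\<close> is then a real linear combination of them.\<close>
  have inner1: "inner (1::'k) 1 = 1" by (simp add: dot_square_norm)
  have bm: "b i \<in> borel_measurable M" if "i \<in> I" for i
    using I(2)[OF that] by (simp add: square_integrable_def)
  have "(1 - \<epsilon>) * card J \<le> card (I \<times> (Basis :: 'k set))"
  proof (rule orthonormal_approximation_card[OF J, where b = "\<lambda>(i, e) x. inner (b i x) e"])
    show "finite (I \<times> (Basis :: 'k set))" using I(1) by simp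
    fix p assume "p \<in> I \<times> (Basis :: 'k set)"
    then obtain i e where p: "p = (i, e)" "i \<in> I" "e \<in> Basis" by auto
    have "integrable M (\<lambda>x. (inner (b i x) e)\<^sup>2)"
    proof (rule Bochner_Integration.integrable_bound)
      show "integrable M (\<lambda>x. (norm (b i x))\<^sup>2)" using I(2)[OF p(2)] by (simp add: square_integrable_def)
      have "(inner (b i x) e)\<^sup>2 \<le> (norm (b i x))\<^sup>2" for x
        using Basis_le_norm[OF p(3), of "b i x"] by (metis abs_ge_zero power2_abs power_mono)
      then show "AE x in M. norm ((inner (b i x) e)\<^sup>2) \<le> norm ((norm (b i x))\<^sup>2)" by simp
    qed (use bm[OF p(2)] in measurable)
    then show "square_integrable M ((\<lambda>(i, e) x. inner (b i x) e) p)"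
      using bm[OF p(2)] by (simp add: p square_integrable_def)
  next
    fix j assume j: "j \<in> J"
    obtain c where c: "(LINT x|M. (norm (of_real (u j x) - (\<Sum>i\<in>I. c i * b i x)))\<^sup>2) \<le> \<epsilon>"
      using approx[OF j] by blast
    have uj: "square_integrable M (u j)" using J(2) j by (simp add: orthonormal_family_def)
    then have uj': "square_integrable M (\<lambda>x. of_real (u j x) :: 'k)"
      by (auto simp: square_integrable_def)
    define r where "r x = of_real (u j x) - (\<Sum>i\<in>I. c i * b i x)" for x
    have r: "square_integrable M r"
      unfolding r_def[abs_def] by (intro square_integrable_diff uj' square_integrable_sum I(2))
    have comp: "(u j x - (\<Sum>p\<in>I \<times> Basis. (inner (c (fst p) * snd p) 1) * (case p of (i, e) \<Rightarrow> \<lambda>x. inner (b i x) e) x)) = inner (r x) 1" for x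
    proof -
      have "inner (c i * b i x) 1 = (\<Sum>e\<in>Basis. (inner (c i * e) 1) * (inner (b i x) e))" for i
      proof -
        have "c i * b i x = c i * (\<Sum>e\<in>Basis. (inner (b i x) e) *\<^sub>R e)" by (simp add: euclidean_representation)
        then show ?thesis by (simp add: sum_distrib_left inner_sum_left mult.commute)
      qed
      then have "inner (\<Sum>i\<in>I. c i * b i x) 1 = (\<Sum>i\<in>I. \<Sum>e\<in>Basis. (inner (c i * e) 1) * (inner (b i x) e))"
        by (simp add: inner_sum_left)
      also have "\<dots> = (\<Sum>p\<in>I \<times> Basis. (inner (c (fst p) * snd p) 1) * (case p of (i, e) \<Rightarrow> \<lambda>x. inner (b i x) e) x)"
        by (simp add: sum.cartesian_product case_prod_beta)
      finally show ?thesis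
        by (simp add: r_def inner_diff_left inner1 of_real_def)
    qed
    have "(LINT x|M. (inner (r x) 1)\<^sup>2) \<le> (LINT x|M. (norm (r x))\<^sup>2)"
    proof (rule integral_mono')
      show "integrable M (\<lambda>x. (norm (r x))\<^sup>2)" using r by (simp add: square_integrable_def)
      show "(inner (r x) 1)\<^sup>2 \<le> (norm (r x))\<^sup>2" for x
        using Cauchy_Schwarz_ineq2[of "r x" 1] by (metis abs_ge_zero mult.right_neutral norm_one power2_abs power_mono)
    qed simp
    then show "\<exists>c. (LINT x|M. (u j x - (\<Sum>p\<in>I \<times> Basis. c p * (case p of (i, e) \<Rightarrow> \<lambda>x. inner (b i x) e) x))\<^sup>2) \<le> \<epsilon>"
      using c by (intro exI[of _ "\<lambda>p. inner (c (fst p) * snd p) 1"]) (simp add: comp r_def)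
  qed
  then show ?thesis by (simp add: card_cartesian_product)
qed

section \<open>Approximation dimension in \<open>L\<^sup>2\<close>\<close>

text \<open>Fekete's lemma: the limit is the infimum of the quotients. Division of \<open>n\<close>
  by \<open>m\<close> with remainder compares \<open>a n\<close> with a near-optimal quotient at
  \<open>m\<close>.\<close>

lemma subadditive_imp_convergent:
  fixes a :: "nat \<Rightarrow> real"
  assumes nonneg: "\<And>n. 0 \<le> a n" and subadd: "\<And>m n. a (m + n) \<le> a m + a n"
  shows "convergent (\<lambda>n. a n / real n)"
proof -
  define L where "L = (INF n\<in>{1..}. a n / real n)"
  have bdd: "bdd_below ((\<lambda>n. a n / real n) ` {1..})"
    by (rule bdd_belowI[of _ 0]) (auto simp: nonneg)
  have mult: "a (q * m + r) \<le> real q * a m + a r" for q m r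
  proof (induction q)
    case (Suc q)
    have "a (Suc q * m + r) \<le> a m + a (q * m + r)" using subadd[of m "q * m + r"] by (simp add: add.assoc)
    then show ?case using Suc by (simp add: algebra_simps)
  qed simp
  have "(\<lambda>n. a n / real n) \<longlonglongrightarrow> L"
  proof (rule order_tendstoI)
    fix c assume "c < L"
    have "L \<le> a n / real n" if "n \<ge> 1" for n
      unfolding L_def using that bdd by (intro cINF_lower) auto
    then show "eventually (\<lambda>n. c < a n / real n) sequentially"
      using \<open>c < L\<close> by (intro eventually_sequentiallyI[of 1]) (meson less_le_trans)
  next
    fix c assume "L < c"
    then obtain m where m: "m \<ge> 1" "a m / real m < c"
      unfolding L_def using bdd by (subst (asm) cINF_less_iff) auto
    \<comment> \<open>One constant for all remainders modulo \<open>m\<close>; nonnegativity lets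
      the sum dominate each summand.\<close>
    define C where "C = (\<Sum>r<m. a r)"
    have "(\<lambda>n. a m / real m + C / real n) \<longlonglongrightarrow> a m / real m + 0"
      by (intro tendsto_add tendsto_const lim_const_over_n)
    then have "eventually (\<lambda>n. a m / real m + C / real n < c) sequentially"
      using m(2) by (intro order_tendstoD) auto
    moreover have "eventually (\<lambda>n. a n / real n \<le> a m / real m + C / real n) sequentially"
    proof (rule eventually_sequentiallyI[of 1])
      fix n :: nat assume n: "1 \<le> n"
      have "a n \<le> real (n div m) * a m + a (n mod m)" using mult[of "n div m" m "n mod m"] by simp
      also have "a (n mod m) \<le> C"
        unfolding C_def using m(1) by (intro member_le_sum) (auto simp: nonneg)
      also have "real (n div m) \<le> real n / real m"
        using m(1) div_times_less_eq_dividend[of n m]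
        by (simp add: pos_le_divide_eq flip: of_nat_mult)
      finally have "a n \<le> real n / real m * a m + C" using nonneg[of m] by (simp add: mult_right_mono)
      then show "a n / real n \<le> a m / real m + C / real n"
        using n by (simp add: field_simps)
    qed
    ultimately show "eventually (\<lambda>n. a n / real n < c) sequentially"
      by eventually_elim simp
  qed
  then show ?thesis by (rule convergentI)
qed

section \<open>Finite families of functions in place of subspaces of classes\<close>

lemma square_integrable_of_real:
  "square_integrable M f \<Longrightarrow>
    square_integrable M (\<lambda>x. of_real (f x) :: 'k::{real_normed_field, second_countable_topology})"
  by (auto simp: square_integrable_def)

text \<open>A finite indexed family stands for the subspace it spans. The index type is free, so
  that families can be joined as disjoint sums and pulled back along the map.\<close>

definition span_approximates ::
    "'a measure \<Rightarrow> 'i set \<Rightarrow> ('i \<Rightarrow> 'a \<Rightarrow> 'k::real_normed_field) \<Rightarrow> ('a \<Rightarrow> 'k) \<Rightarrow> real \<Rightarrow> bool" where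
  "span_approximates M I b f \<delta> \<longleftrightarrow>
     (\<exists>c. sqrt (LINT x|M. (norm (f x - (\<Sum>i\<in>I. c i * b i x)))\<^sup>2) < \<delta>)"

lemma minus_L2_class:
  fixes f g :: "'a \<Rightarrow> 'k::{real_normed_field, second_countable_topology}"
  assumes f: "square_integrable M f" and g: "square_integrable M g"
  shows "L2_class M f \<ominus>\<^bsub>L2 M\<^esub> L2_class M g = L2_class M (\<lambda>x. f x - g x)"
proof -
  interpret V: vectorspace class_ring "L2 M :: ('k, ('a \<Rightarrow> 'k) set) normed_module"
    by (rule vectorspace_L2)
  have g': "square_integrable M (\<lambda>x. - 1 * g x)" by (rule square_integrable_mult[OF g])
  have "\<ominus>\<^bsub>L2 M\<^esub> L2_class M g = L2_class M (\<lambda>x. - 1 * g x)"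
  proof (rule V.minus_equality)
    show "L2_class M (\<lambda>x. - 1 * g x) \<oplus>\<^bsub>L2 M\<^esub> L2_class M g = \<zero>\<^bsub>L2 M\<^esub>"
      by (subst add_L2_class[OF g' g]) (simp add: zero_L2)
  qed (use g g' in \<open>auto simp: carrier_L2\<close>)
  then show ?thesis
    using add_L2_class[OF f g'] by (simp add: a_minus_def)
qed

lemma L2_rep_carrier:
  fixes F :: "('a \<Rightarrow> 'k::real_normed_field) set"
  assumes "F \<in> carrier (L2 M)"
  shows "square_integrable M (L2_rep F)" "L2_class M (L2_rep F) = F"
proof -
  obtain f where f: "square_integrable M f" "F = L2_class M f"
    using assms by (auto simp: carrier_L2)
  show "square_integrable M (L2_rep F)" using L2_rep_class(1)[OF f(1)] f(2) by simp
  then show "L2_class M (L2_rep F) = F"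
    using L2_rep_class(2)[OF f(1)] f L2_class_eq_iff[OF f(1), of "L2_rep F"] by simp
qed

lemma lincomb_L2:
  fixes A :: "('a \<Rightarrow> 'k::{real_normed_field, second_countable_topology}) set set"
  assumes "finite A" "A \<subseteq> carrier (L2 M)"
  shows "module.lincomb (L2 M) a A = L2_class M (\<lambda>x. \<Sum>F\<in>A. a F * L2_rep F x)"
proof -
  interpret V: vectorspace class_ring "L2 M :: ('k, ('a \<Rightarrow> 'k) set) normed_module"
    by (rule vectorspace_L2)
  show ?thesis
    using assms
  proof (induction A)
    case empty
    then show ?case by (simp add: V.lincomb_def zero_L2)
  next
    case (insert F A)
    have F: "square_integrable M (L2_rep F)" "L2_class M (L2_rep F) = F"
      using L2_rep_carrier[of F M] insert.prems by auto
    have A: "square_integrable M (\<lambda>x. \<Sum>F\<in>A. a F * L2_rep F x)"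
      using insert.prems L2_rep_carrier(1) by (intro square_integrable_sum) auto
    have "V.lincomb a (insert F A) = (a F \<odot>\<^bsub>L2 M\<^esub> F) \<oplus>\<^bsub>L2 M\<^esub> V.lincomb a A"
      using V.lincomb_insert[of A a F] insert by auto
    also have "a F \<odot>\<^bsub>L2 M\<^esub> F = L2_class M (\<lambda>x. a F * L2_rep F x)"
      using smult_L2_class[OF F(1), of "a F"] F(2) by simp
    also have "V.lincomb a A = L2_class M (\<lambda>x. \<Sum>F\<in>A. a F * L2_rep F x)"
      using insert by simp
    finally show ?case
      using insert.hyps by (simp add: add_L2_class[OF square_integrable_mult[OF F(1)] A])
  qed
qed

text \<open>The classes of the \<open>b i\<close> span a subspace of dimension at most
  \<open>card I\<close>, coincidences and dependencies only lowering it. The first conclusion is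
  stated separately because \<open>LEAST\<close> is informative only once some admissible dimension
  is known.\<close>

lemma apr_dim_le_card:
  fixes b :: "'i \<Rightarrow> 'a \<Rightarrow> 'k::{real_normed_field, second_countable_topology}"
  assumes I: "finite I" "\<And>i. i \<in> I \<Longrightarrow> square_integrable M (b i)"
    and \<Omega>: "\<And>f. f \<in> \<Omega> \<Longrightarrow> square_integrable M f" "\<And>f. f \<in> \<Omega> \<Longrightarrow> span_approximates M I b f \<delta>"
  shows "\<exists>E d. VectorSpace.subspace class_ring E (L2 M) \<and>
     vectorspace.fin_dim class_ring ((L2 M)\<lparr>carrier := E\<rparr>) \<and>
     vectorspace.dim class_ring ((L2 M)\<lparr>carrier := E\<rparr>) = d \<and>
     approximates (L2 M) (L2_class M ` \<Omega>) \<delta> E"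
    and "apr_dim (L2 M) (L2_class M ` \<Omega>) \<delta> \<le> card I"
proof -
  interpret V: vectorspace class_ring "L2 M :: ('k, ('a \<Rightarrow> 'k) set) normed_module"
    by (rule vectorspace_L2)
  define S where "S = (\<lambda>i. L2_class M (b i)) ` I"
  have S: "finite S" "S \<subseteq> carrier (L2 M)" "card S \<le> card I"
    using I by (auto simp: S_def carrier_L2 card_image_le)
  define E where "E = V.span S"
  have sub: "VectorSpace.subspace class_ring E (L2 M)"
    unfolding E_def by (rule V.span_is_subspace[OF S(2)])
  interpret W: vectorspace class_ring "(L2 M)\<lparr>carrier := E\<rparr>"
    by (rule V.subspace_is_vs[OF sub])
  have SE: "S \<subseteq> E" unfolding E_def by (rule V.in_own_span[OF S(2)])
  have gen: "W.gen_set S"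
    using V.span_li_not_depend(1)[OF SE] sub by (simp add: E_def subspace_def)
  have fd: "W.fin_dim" unfolding W.fin_dim_def using S(1) SE gen by auto
  have dim: "W.dim \<le> card I"
    using W.gen_ge_dim[OF S(1) _ gen] SE S(3) by simp
  have comb: "L2_class M (\<lambda>x. \<Sum>i\<in>J. c i * b i x) \<in> E" if "J \<subseteq> I" for J c
    using finite_subset[OF that I(1)] that
  proof (induction J)
    case empty
    then show ?case using W.zero_closed by (simp add: zero_L2)
  next
    case (insert i J)
    have i: "square_integrable M (b i)" using insert.prems I(2) by auto
    have J: "square_integrable M (\<lambda>x. \<Sum>i\<in>J. c i * b i x)"
      using insert.prems I(2) by (intro square_integrable_sum) auto
    have "L2_class M (b i) \<in> E" using SE insert.prems by (auto simp: S_def)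
    then have "L2_class M (\<lambda>x. c i * b i x) \<in> E"
      using W.smult_closed[of "c i" "L2_class M (b i)"] smult_L2_class[OF i, of "c i"] by simp
    moreover have "L2_class M (\<lambda>x. \<Sum>i\<in>J. c i * b i x) \<in> E" using insert by simp
    ultimately have "L2_class M (\<lambda>x. c i * b i x) \<oplus>\<^bsub>L2 M\<^esub> L2_class M (\<lambda>x. \<Sum>i\<in>J. c i * b i x) \<in> E"
      using W.a_closed by simp
    then show ?case
      using insert.hyps by (simp add: add_L2_class[OF square_integrable_mult[OF i] J])
  qed
  have appr: "approximates (L2 M) (L2_class M ` \<Omega>) \<delta> E"
    unfolding approximates_def
  proof
    fix F assume "F \<in> L2_class M ` \<Omega>"
    then obtain f where f: "f \<in> \<Omega>" "F = L2_class M f" by auto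
    then obtain c where c: "sqrt (LINT x|M. (norm (f x - (\<Sum>i\<in>I. c i * b i x)))\<^sup>2) < \<delta>"
      using \<Omega>(2) by (auto simp: span_approximates_def)
    have s: "square_integrable M (\<lambda>x. \<Sum>i\<in>I. c i * b i x)"
      using I(2) by (rule square_integrable_sum)
    have "vnorm (L2 M) (F \<ominus>\<^bsub>L2 M\<^esub> L2_class M (\<lambda>x. \<Sum>i\<in>I. c i * b i x)) < \<delta>"
      using c by (simp add: f minus_L2_class[OF \<Omega>(1)[OF f(1)] s]
          vnorm_L2_class[OF square_integrable_diff[OF \<Omega>(1)[OF f(1)] s]])
    then show "\<exists>y\<in>E. vnorm (L2 M) (F \<ominus>\<^bsub>L2 M\<^esub> y) < \<delta>" using comb[of I c] by auto
  qed
  show "\<exists>E d. VectorSpace.subspace class_ring E (L2 M) \<and>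
     vectorspace.fin_dim class_ring ((L2 M)\<lparr>carrier := E\<rparr>) \<and>
     vectorspace.dim class_ring ((L2 M)\<lparr>carrier := E\<rparr>) = d \<and>
     approximates (L2 M) (L2_class M ` \<Omega>) \<delta> E"
    using sub fd appr by blast
  have "apr_dim (L2 M) (L2_class M ` \<Omega>) \<delta> \<le> W.dim"
    unfolding apr_dim_def by (rule Least_le) (use sub fd appr in blast)
  with dim show "apr_dim (L2 M) (L2_class M ` \<Omega>) \<delta> \<le> card I" by simp
qed

text \<open>The converse direction: the minimum is attained, and a basis of a minimising subspace is
  a family of exactly that size. Its elements are classes, hence the index type;
  \<open>L2_rep\<close> turns them into functions.\<close>

lemma apr_dim_witness:
  fixes \<Omega> :: "('a \<Rightarrow> 'k::{real_normed_field, second_countable_topology}) set"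
  assumes fin: "finite \<Omega>" and sqs: "\<forall>f\<in>\<Omega>. square_integrable M f" and \<delta>: "\<delta> > 0"
  shows "\<exists>(b :: ('a \<Rightarrow> 'k) set \<Rightarrow> 'a \<Rightarrow> 'k) I.
    finite I \<and> card I = apr_dim (L2 M) (L2_class M ` \<Omega>) \<delta> \<and>
    (\<forall>i\<in>I. square_integrable M (b i)) \<and> (\<forall>f\<in>\<Omega>. span_approximates M I b f \<delta>)"
proof -
  interpret V: vectorspace class_ring "L2 M :: ('k, ('a \<Rightarrow> 'k) set) normed_module"
    by (rule vectorspace_L2)
  have sq: "square_integrable M f" if "f \<in> \<Omega>" for f using sqs that by blast
  \<comment> \<open>A finite set lies in its own span, so admissible dimensions exist.\<close>
  have "span_approximates M \<Omega> (\<lambda>g. g) f \<delta>" if "f \<in> \<Omega>" for f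
  proof -
    have "(\<Sum>g\<in>\<Omega>. (if g = f then 1 else 0) * g x) = f x" for x
      using fin that by (simp add: if_distrib[of "\<lambda>c. c * _"] cong: if_cong)
    then show ?thesis
      unfolding span_approximates_def using \<delta> by (intro exI[of _ "\<lambda>g. if g = f then 1 else 0"]) simp
  qed
  from apr_dim_le_card(1)[OF fin sq sq this]
  have "\<exists>d. \<exists>E. VectorSpace.subspace class_ring E (L2 M) \<and>
     vectorspace.fin_dim class_ring ((L2 M)\<lparr>carrier := E\<rparr>) \<and>
     vectorspace.dim class_ring ((L2 M)\<lparr>carrier := E\<rparr>) = d \<and>
     approximates (L2 M) (L2_class M ` \<Omega>) \<delta> E" by blast
  from LeastI_ex[OF this] obtain E where sub: "VectorSpace.subspace class_ring E (L2 M)"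
    and fd: "vectorspace.fin_dim class_ring ((L2 M)\<lparr>carrier := E\<rparr>)"
    and dim: "vectorspace.dim class_ring ((L2 M)\<lparr>carrier := E\<rparr>) = apr_dim (L2 M) (L2_class M ` \<Omega>) \<delta>"
    and appr: "approximates (L2 M) (L2_class M ` \<Omega>) \<delta> E"
    unfolding apr_dim_def by blast
  interpret W: vectorspace class_ring "(L2 M)\<lparr>carrier := E\<rparr>"
    by (rule V.subspace_is_vs[OF sub])
  obtain \<beta> where \<beta>: "finite \<beta>" "W.basis \<beta>" using W.finite_basis_exists[OF fd] by auto
  have subm: "submodule class_ring E (L2 M)" using sub by (simp add: subspace_def)
  then have EV: "E \<subseteq> carrier (L2 M)" by (rule submodule.subset)
  have \<beta>E: "\<beta> \<subseteq> E" using \<beta>(2) by (simp add: W.basis_def)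
  have span: "V.span \<beta> = E"
    using \<beta>(2) V.span_li_not_depend(1)[OF \<beta>E subm] by (simp add: W.basis_def)
  show ?thesis
  proof (intro exI conjI ballI)
    show "card \<beta> = apr_dim (L2 M) (L2_class M ` \<Omega>) \<delta>" using W.dim_basis[OF \<beta>] dim by simp
    show sq\<beta>: "square_integrable M (L2_rep F)" if "F \<in> \<beta>" for F
      using that \<beta>E EV L2_rep_carrier(1) by blast
    fix f assume f: "f \<in> \<Omega>"
    then obtain y where y: "y \<in> E" "vnorm (L2 M) (L2_class M f \<ominus>\<^bsub>L2 M\<^esub> y) < \<delta>"
      using appr by (auto simp: approximates_def)
    obtain a where a: "V.lincomb a \<beta> = y"
      using V.finite_in_span[OF \<beta>(1), of y] y(1) \<beta>E EV span by auto
    have s: "square_integrable M (\<lambda>x. \<Sum>F\<in>\<beta>. a F * L2_rep F x)"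
      using sq\<beta> by (rule square_integrable_sum)
    have "y = L2_class M (\<lambda>x. \<Sum>F\<in>\<beta>. a F * L2_rep F x)"
      using a lincomb_L2[OF \<beta>(1), of M a] \<beta>E EV by auto
    then have "sqrt (LINT x|M. (norm (f x - (\<Sum>F\<in>\<beta>. a F * L2_rep F x)))\<^sup>2) < \<delta>"
      using y(2) by (simp add: minus_L2_class[OF sq[OF f] s] vnorm_L2_class[OF square_integrable_diff[OF sq[OF f] s]])
    then show "span_approximates M \<beta> L2_rep f \<delta>"
      unfolding span_approximates_def by blast
  qed (rule \<beta>)
qed

section \<open>Approximation entropy of Koopman operators\<close>

context measure_preserving_system
begin

lemma measure_preserving_system_funpow: "measure_preserving_system M (\<phi> ^^ k)"
proof (induction k)
  case 0
  show ?case by unfold_locales (use measurable_space in auto)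
next
  case (Suc k)
  interpret P: measure_preserving_system M "\<phi> ^^ k" by (rule Suc)
  show ?case
  proof
    show "(\<phi> ^^ Suc k) \<in> measurable M M"
      using measurable_comp[OF P.measurable_map measurable_map] by (simp add: comp_def)
    fix A assume A: "A \<in> sets M"
    have "(\<phi> ^^ Suc k) -` A \<inter> space M = (\<phi> ^^ k) -` (\<phi> -` A \<inter> space M) \<inter> space M"
      using measurable_space[OF P.measurable_map] by auto
    then show "measure M ((\<phi> ^^ Suc k) -` A \<inter> space M) = measure M A"
      using A P.measure_preserving[OF measurable_sets[OF measurable_map A]] measure_preserving[OF A] by simp
  qed
qed

lemma integral_comp:
  fixes f :: "'a \<Rightarrow> 'b::{banach, second_countable_topology}"
  assumes "f \<in> borel_measurable M"
  shows "(LINT x|M. f (\<phi> x)) = (LINT x|M. f x)"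
  using integral_distr[OF measurable_map assms] by (simp add: distr_map)

lemma koopman_funpow_L2_class:
  fixes f :: "'a \<Rightarrow> 'k::{real_normed_field, second_countable_topology}"
  assumes f: "square_integrable M f"
  shows "(koopman M \<phi> ^^ k) (L2_class M f) = L2_class M (f \<circ> (\<phi> ^^ k))"
proof (induction k)
  case (Suc k)
  interpret P: measure_preserving_system M "\<phi> ^^ k" by (rule measure_preserving_system_funpow)
  have "(koopman M \<phi> ^^ Suc k) (L2_class M f) = koopman M \<phi> ((koopman M \<phi> ^^ k) (L2_class M f))"
    by simp
  also have "\<dots> = L2_class M (f \<circ> (\<phi> ^^ k) \<circ> \<phi>)"
    unfolding Suc by (rule koopman_L2_class[OF P.square_integrable_comp[OF f]])
  also have "f \<circ> (\<phi> ^^ k) \<circ> \<phi> = f \<circ> (\<phi> ^^ Suc k)"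
    by (simp only: funpow_Suc_right comp_assoc)
  finally show ?case .
qed simp

text \<open>Composition is linear and preserves the norm, so the same coefficients serve.\<close>

lemma span_approximates_comp:
  fixes f :: "'a \<Rightarrow> 'k::{real_normed_field, second_countable_topology}"
  assumes "\<And>i. i \<in> I \<Longrightarrow> square_integrable M (b i)" "square_integrable M f"
    and "span_approximates M I b f \<delta>"
  shows "span_approximates M I (\<lambda>i. b i \<circ> \<phi>) (f \<circ> \<phi>) \<delta>"
proof -
  obtain c where c: "sqrt (LINT x|M. (norm (f x - (\<Sum>i\<in>I. c i * b i x)))\<^sup>2) < \<delta>"
    using assms(3) by (auto simp: span_approximates_def)
  have "square_integrable M (\<lambda>x. f x - (\<Sum>i\<in>I. c i * b i x))"
    by (intro square_integrable_diff square_integrable_sum assms)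
  then have "(\<lambda>x. (norm (f x - (\<Sum>i\<in>I. c i * b i x)))\<^sup>2) \<in> borel_measurable M"
    by (auto simp: square_integrable_def)
  from integral_comp[OF this] c show ?thesis
    unfolding span_approximates_def by (intro exI[of _ c]) simp
qed

end

lemma orthonormal_family_orbitsD:
  assumes "orthonormal_family M (UNIV \<times> {..<K}) (\<lambda>(k, i). e i \<circ> (\<phi> ^^ k))" "i < K"
  shows "square_integrable M (e i)"
proof -
  have "(0, i) \<in> UNIV \<times> {..<K}" using assms(2) by simp
  from bspec[OF conjunct1[OF assms(1)[unfolded orthonormal_family_def]] this]
  show ?thesis by (simp add: comp_def)
qed

lemma span_approximates_PlusI1:
  assumes "finite I" "finite J" "span_approximates M I b f \<delta>"
  shows "span_approximates M (I <+> J) (case_sum b b') f \<delta>"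
proof -
  obtain c where "sqrt (LINT x|M. (norm (f x - (\<Sum>i\<in>I. c i * b i x)))\<^sup>2) < \<delta>"
    using assms(3) by (auto simp: span_approximates_def)
  then show ?thesis
    unfolding span_approximates_def
    by (intro exI[of _ "case_sum c (\<lambda>_. 0)"]) (simp add: sum.Plus assms)
qed

lemma span_approximates_PlusI2:
  assumes "finite I" "finite J" "span_approximates M J b' f \<delta>"
  shows "span_approximates M (I <+> J) (case_sum b b') f \<delta>"
proof -
  obtain c where "sqrt (LINT x|M. (norm (f x - (\<Sum>i\<in>J. c i * b' i x)))\<^sup>2) < \<delta>"
    using assms(3) by (auto simp: span_approximates_def)
  then show ?thesis
    unfolding span_approximates_def
    by (intro exI[of _ "case_sum (\<lambda>_. 0) c"]) (simp add: sum.Plus assms)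
qed

section \<open>Subadditivity along orbits and the lower bound from orthonormal orbits\<close>

context measure_preserving_system
begin

text \<open>The orbit segment of length \<open>m + n\<close> consists of the one of length
  \<open>m\<close> and the pullback along \<open>\<phi> ^^ m\<close> of the one of length
  \<open>n\<close>. Pulling back preserves distances, so the sum of two approximating spaces
  serves.\<close>

lemma apr_dim_orbit_subadditive:
  fixes \<Omega> :: "('a \<Rightarrow> 'k::{real_normed_field, second_countable_topology}) set"
  assumes fin: "finite \<Omega>" and sq: "\<And>f. f \<in> \<Omega> \<Longrightarrow> square_integrable M f" and \<delta>: "\<delta> > 0"
  defines "\<omega> \<equiv> L2_class M ` \<Omega>"
  shows "apr_dim (L2 M) (\<Union>k<m + n. (koopman M \<phi> ^^ k) ` \<omega>) \<delta> \<le>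
    apr_dim (L2 M) (\<Union>k<m. (koopman M \<phi> ^^ k) ` \<omega>) \<delta> + apr_dim (L2 M) (\<Union>k<n. (koopman M \<phi> ^^ k) ` \<omega>) \<delta>"
proof -
  define U where "U n = (\<Union>k<n. (\<lambda>f. f \<circ> (\<phi> ^^ k)) ` \<Omega>)" for n
  have orb: "(\<Union>k<n. (koopman M \<phi> ^^ k) ` \<omega>) = L2_class M ` U n" for n
    using sq by (simp add: \<omega>_def U_def image_UN image_image koopman_funpow_L2_class)
  have sqc: "square_integrable M (f \<circ> (\<phi> ^^ k))" if "square_integrable M f" for f :: "'a \<Rightarrow> 'k" and k
    using measure_preserving_system.square_integrable_comp[OF measure_preserving_system_funpow that] .
  have finU: "finite (U n)" for n using fin by (simp add: U_def)
  have sqU: "\<forall>f\<in>U n. square_integrable M f" for n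
    using sqc sq by (auto simp: U_def)
  have split: "f \<in> U m \<or> (\<exists>g\<in>U n. f = g \<circ> (\<phi> ^^ m))" if "f \<in> U (m + n)" for f
  proof -
    obtain k g where g: "k < m + n" "g \<in> \<Omega>" "f = g \<circ> (\<phi> ^^ k)" using \<open>f \<in> U (m + n)\<close> by (auto simp: U_def)
    show ?thesis
    proof (cases "k < m")
      case False
      then have "f = (g \<circ> (\<phi> ^^ (k - m))) \<circ> (\<phi> ^^ m)"
        using g(3) funpow_add[of "k - m" m \<phi>] by (simp add: comp_assoc)
      moreover have "g \<circ> (\<phi> ^^ (k - m)) \<in> U n" using g(1,2) False by (auto simp: U_def)
      ultimately show ?thesis by blast
    qed (use g in \<open>auto simp: U_def\<close>)
  qed
  obtain b :: "('a \<Rightarrow> 'k) set \<Rightarrow> 'a \<Rightarrow> 'k" and I where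
    I: "finite I" "card I = apr_dim (L2 M) (L2_class M ` U m) \<delta>" "\<forall>i\<in>I. square_integrable M (b i)"
      "\<forall>f\<in>U m. span_approximates M I b f \<delta>"
    using apr_dim_witness[OF finU[of m] sqU \<delta>] by (elim exE conjE)
  obtain b' :: "('a \<Rightarrow> 'k) set \<Rightarrow> 'a \<Rightarrow> 'k" and J where
    J: "finite J" "card J = apr_dim (L2 M) (L2_class M ` U n) \<delta>" "\<forall>i\<in>J. square_integrable M (b' i)"
      "\<forall>f\<in>U n. span_approximates M J b' f \<delta>"
    using apr_dim_witness[OF finU[of n] sqU \<delta>] by (elim exE conjE)
  let ?b = "case_sum b (\<lambda>i. b' i \<circ> (\<phi> ^^ m))"
  have "apr_dim (L2 M) (L2_class M ` U (m + n)) \<delta> \<le> card (I <+> J)"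
  proof (rule apr_dim_le_card(2)[where b = ?b])
    show "finite (I <+> J)" using I(1) J(1) by simp
    show "square_integrable M (?b i)" if "i \<in> I <+> J" for i
      using that I(3) J(3) sqc by auto
    show "square_integrable M f" if "f \<in> U (m + n)" for f using sqU that by blast
    fix f assume "f \<in> U (m + n)"
    from split[OF this] show "span_approximates M (I <+> J) ?b f \<delta>"
    proof
      assume "f \<in> U m"
      then show ?thesis using I J by (intro span_approximates_PlusI1) auto
    next
      assume "\<exists>g\<in>U n. f = g \<circ> (\<phi> ^^ m)"
      then obtain g where g: "g \<in> U n" "f = g \<circ> (\<phi> ^^ m)" by blast
      interpret P: measure_preserving_system M "\<phi> ^^ m" by (rule measure_preserving_system_funpow)
      have "span_approximates M J (\<lambda>i. b' i \<circ> (\<phi> ^^ m)) f \<delta>"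
        unfolding g(2) using J(3,4) g(1) by (intro P.span_approximates_comp bspec[OF sqU g(1)]) auto
      then show ?thesis by (intro span_approximates_PlusI2 I J)
    qed
  qed
  then show ?thesis
    unfolding orb using I(1,2) J(1,2) by (simp add: card_Plus)
qed

text \<open>Tolerance 1/2 means squared error 1/4, which leaves the factor 3/4 in the dimension
  count. The first \<open>n\<close> steps contain \<open>n * K\<close> orthonormal vectors, so the
  dimension grows at least linearly in \<open>n\<close>.\<close>

lemma apr_entropy_at_orthonormal_orbits:
  fixes e :: "nat \<Rightarrow> 'a \<Rightarrow> real"
  assumes orth: "orthonormal_family M (UNIV \<times> {..<K}) (\<lambda>(k, i). e i \<circ> (\<phi> ^^ k))"
  shows "3 / 4 * real K / DIM('k) \<le>
    apr_entropy_at (L2 M :: ('k::{real_normed_field, euclidean_space}, ('a \<Rightarrow> 'k) set) normed_module)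
      (koopman M \<phi>) (L2_class M ` ((\<lambda>i x. of_real (e i x)) ` {..<K})) (1 / 2)"
proof -
  define E where "E i x = (of_real (e i x) :: 'k)" for i x
  define \<omega> where "\<omega> = L2_class M ` (E ` {..<K})"
  define a where "a n = apr_dim (L2 M) (\<Union>k<n. (koopman M \<phi> ^^ k) ` \<omega>) (1 / 2)" for n
  have sqe: "square_integrable M (e i)" if "i < K" for i
    by (rule orthonormal_family_orbitsD[OF orth that])
  then have sqE: "square_integrable M (E i)" if "i < K" for i
    using that unfolding E_def[abs_def] by (intro square_integrable_of_real)
  \<comment> \<open>\<open>lim\<close> can be compared with the terms only if the sequence
    converges; subadditivity provides this.\<close>
  have "real (a (m + n)) \<le> real (a m) + real (a n)" for m n
    unfolding a_def \<omega>_def of_nat_add[symmetric] of_nat_le_iff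
    by (rule apr_dim_orbit_subadditive) (use sqE in auto)
  then have "convergent (\<lambda>n. real (a n) / real n)"
    by (intro subadditive_imp_convergent) auto
  then have lim: "(\<lambda>n. real (a n) / real n) \<longlonglongrightarrow> apr_entropy_at (L2 M) (koopman M \<phi>) \<omega> (1 / 2)"
    by (simp add: apr_entropy_at_def a_def convergent_LIMSEQ_iff)
  \<comment> \<open>At \<open>n = 0\<close> the quotient is 0 by convention, hence the
    restriction.\<close>
  have lower: "3 / 4 * real K / DIM('k) \<le> real (a n) / real n" if "n \<ge> 1" for n
  proof -
    define U where "U = (\<Union>k<n. (\<lambda>f. f \<circ> (\<phi> ^^ k)) ` (E ` {..<K}))"
    have finU: "finite U" by (simp add: U_def)
    have orb: "(\<Union>k<n. (koopman M \<phi> ^^ k) ` \<omega>) = L2_class M ` U"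
      using sqE by (simp add: \<omega>_def U_def image_UN image_image koopman_funpow_L2_class)
    have sqU: "\<forall>f\<in>U. square_integrable M f"
      using sqE measure_preserving_system.square_integrable_comp[OF measure_preserving_system_funpow]
      by (auto simp: U_def)
    obtain b :: "('a \<Rightarrow> 'k) set \<Rightarrow> 'a \<Rightarrow> 'k" and I where
      I: "finite I" "card I = apr_dim (L2 M) (L2_class M ` U) (1 / 2)" "\<forall>i\<in>I. square_integrable M (b i)"
        "\<forall>f\<in>U. span_approximates M I b f (1 / 2)"
      using apr_dim_witness[OF finU sqU, of "1 / 2", simplified] by (elim exE conjE)
    have "(1 - 1 / 4) * real (card ({..<n} \<times> {..<K})) \<le> real (card I * DIM('k))"
    proof (rule orthonormal_approximation_dim[where b = b])
      show "orthonormal_family M ({..<n} \<times> {..<K}) (\<lambda>(k, i). e i \<circ> (\<phi> ^^ k))"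
        using orth by (auto simp: orthonormal_family_def)
      fix j assume "j \<in> {..<n} \<times> {..<K}"
      then obtain k i where j: "j = (k, i)" "k < n" "i < K" by auto
      then have "E i \<circ> (\<phi> ^^ k) \<in> U" by (auto simp: U_def)
      with I(4) obtain c where c: "sqrt (LINT x|M. (norm (E i ((\<phi> ^^ k) x) - (\<Sum>i\<in>I. c i * b i x)))\<^sup>2) < 1 / 2"
        by (auto simp: span_approximates_def)
      then have "(LINT x|M. (norm (E i ((\<phi> ^^ k) x) - (\<Sum>i\<in>I. c i * b i x)))\<^sup>2) \<le> (1 / 2)\<^sup>2"
        by (rule less_imp_le[THEN sqrt_le_D])
      then show "\<exists>c. (LINT x|M. (norm (of_real ((case j of (k, i) \<Rightarrow> e i \<circ> (\<phi> ^^ k)) x) - (\<Sum>i\<in>I. c i * b i x)))\<^sup>2) \<le> 1 / 4"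
        by (intro exI[of _ c]) (simp add: j E_def power2_eq_square)
    qed (use I in auto)
    then have "3 / 4 * (real n * real K) \<le> real (a n) * DIM('k)"
      by (simp add: a_def orb I(2))
    then show ?thesis using that by (simp add: field_simps)
  qed
  have "3 / 4 * real K / DIM('k) \<le> apr_entropy_at (L2 M) (koopman M \<phi>) \<omega> (1 / 2)"
    by (rule LIMSEQ_le_const[OF lim]) (use lower in auto)
  then show ?thesis by (simp add: \<omega>_def E_def[abs_def])
qed

text \<open>Only the finite set \<omega> varies: the tolerance stays at 1/2 while the number of
  orbits grows.\<close>

lemma apr_entropy_infinite:
  assumes "\<And>K. \<exists>e :: nat \<Rightarrow> 'a \<Rightarrow> real. orthonormal_family M (UNIV \<times> {..<K}) (\<lambda>(k, i). e i \<circ> (\<phi> ^^ k))"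
  shows "apr_entropy (L2 M :: ('k::{real_normed_field, euclidean_space}, ('a \<Rightarrow> 'k) set) normed_module)
      (koopman M \<phi>) = \<infinity>"
proof (rule ereal_top)
  fix B :: real
  obtain K :: nat where "4 / 3 * B * DIM('k) \<le> real K" using real_arch_simple by blast
  then have K: "B \<le> 3 / 4 * real K / DIM('k)" by (simp add: field_simps)
  obtain e :: "nat \<Rightarrow> 'a \<Rightarrow> real" where orth: "orthonormal_family M (UNIV \<times> {..<K}) (\<lambda>(k, i). e i \<circ> (\<phi> ^^ k))"
    using assms by blast
  define \<omega> where "\<omega> = L2_class M ` ((\<lambda>i x. of_real (e i x) :: 'k) ` {..<K})"
  have "square_integrable M (e i)" if "i < K" for i
    by (rule orthonormal_family_orbitsD[OF orth that])
  then have sq: "square_integrable M (\<lambda>x. of_real (e i x) :: 'k)" if "i < K" for i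
    using that by (intro square_integrable_of_real)
  have "ereal B \<le> ereal (apr_entropy_at (L2 M) (koopman M \<phi>) \<omega> (1 / 2))"
    using K apr_entropy_at_orthonormal_orbits[OF orth, where 'k = 'k] by (simp add: \<omega>_def)
  also have "\<dots> \<le> apr_entropy_of (L2 M) (koopman M \<phi>) \<omega>"
    unfolding apr_entropy_of_def by (rule SUP_upper) simp
  also have "\<dots> \<le> apr_entropy (L2 M :: ('k, ('a \<Rightarrow> 'k) set) normed_module) (koopman M \<phi>)"
    unfolding apr_entropy_def by (intro SUP_upper) (use sq in \<open>auto simp: \<omega>_def carrier_L2\<close>)
  finally show "ereal B \<le> apr_entropy (L2 M :: ('k, ('a \<Rightarrow> 'k) set) normed_module) (koopman M \<phi>)" .
qed

end

section \<open>Innovations\<close>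

lemma (in prob_space) AE_bounded_square_integrable:
  assumes "g \<in> borel_measurable M" "AE x in M. \<bar>g x\<bar> \<le> (1::real)"
  shows "square_integrable M g"
proof -
  have "integrable M (\<lambda>x. (g x)\<^sup>2)"
  proof (rule integrable_const_bound[of _ 1])
    show "AE x in M. norm ((g x)\<^sup>2) \<le> 1"
      using assms(2) by eventually_elim (simp add: abs_square_le_1)
  qed (use assms(1) in measurable)
  then show ?thesis using assms(1) by (simp add: square_integrable_def)
qed

text \<open>The points of \<open>D\<close> that never return form a set whose preimages under the
  iterates are pairwise disjoint and of equal measure, hence null. If all return sets were null as
  well, \<open>D\<close> would be null.\<close>

lemma (in measure_preserving_system) poincare_recurrence:
  assumes D: "D \<in> sets M" "measure M D > 0"
  shows "\<exists>p\<ge>1. measure M (D \<inter> ((\<phi> ^^ p) -` D \<inter> space M)) > 0"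
proof (rule ccontr)
  assume neg: "\<not> ?thesis"
  have meas: "(\<phi> ^^ k) \<in> measurable M M" for k
    using measure_preserving_system_funpow[of k] by (rule measure_preserving_system.measurable_map)
  define R where "R = D - (\<Union>p\<in>{1..}. (\<phi> ^^ p) -` D \<inter> space M)"
  have R: "R \<in> sets M" unfolding R_def by (intro sets.Diff D(1) sets.countable_UN'' measurable_sets[OF meas D(1)]) simp
  define V where "V n = (\<phi> ^^ n) -` R \<inter> space M" for n
  have V: "V n \<in> sets M" for n unfolding V_def by (rule measurable_sets[OF meas R])
  have mV: "measure M (V n) = measure M R" for n
    unfolding V_def using measure_preserving_system_funpow[of n] R by (rule measure_preserving_system.measure_preserving)
  have "disjoint_family V"
  proof -
    have "V i \<inter> V j = {}" if "i < j" for i j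
    proof (rule ccontr)
      assume "V i \<inter> V j \<noteq> {}"
      then obtain x where x: "x \<in> space M" "(\<phi> ^^ i) x \<in> R" "(\<phi> ^^ j) x \<in> R" by (auto simp: V_def)
      have "(\<phi> ^^ j) x = (\<phi> ^^ (j - i)) ((\<phi> ^^ i) x)"
        using funpow_add[of "j - i" i \<phi>] that by simp
      then have "(\<phi> ^^ i) x \<in> (\<phi> ^^ (j - i)) -` D \<inter> space M"
        using x measurable_space[OF meas x(1)] by (auto simp: R_def)
      moreover have "j - i \<in> {1..}" using that by simp
      ultimately show False using x(2) unfolding R_def by blast
    qed
    then show ?thesis unfolding disjoint_family_on_def by (metis inf_commute linorder_neqE_nat)
  qed
  then have "(\<lambda>n. measure M (V n)) sums measure M (\<Union>n. V n)"
    using V by (intro finite_measure_UNION) auto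
  then have "measure M R = 0"
    using summable_const_iff[of "measure M R"] by (auto simp: mV dest: sums_summable)
  then have "R \<in> null_sets M" using R by (simp add: null_sets_def emeasure_eq_measure)
  moreover have "(\<Union>p\<in>{1..}. D \<inter> ((\<phi> ^^ p) -` D \<inter> space M)) \<in> null_sets M"
  proof (rule null_sets_UN')
    fix p :: nat assume "p \<in> {1..}"
    then have "measure M (D \<inter> ((\<phi> ^^ p) -` D \<inter> space M)) = 0"
      using neg measure_nonneg[of M] by (metis atLeast_iff less_le)
    then show "D \<inter> ((\<phi> ^^ p) -` D \<inter> space M) \<in> null_sets M"
      using sets.Int[OF D(1) measurable_sets[OF meas D(1)]] by (simp add: null_sets_def emeasure_eq_measure)
  qed simp
  ultimately have "R \<union> (\<Union>p\<in>{1..}. D \<inter> ((\<phi> ^^ p) -` D \<inter> space M)) \<in> null_sets M" by blast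
  moreover have "D \<subseteq> R \<union> (\<Union>p\<in>{1..}. D \<inter> ((\<phi> ^^ p) -` D \<inter> space M))" by (auto simp: R_def)
  ultimately have "D \<in> null_sets M" using D(1) by (meson null_sets_subset)
  then show False using D(2) by (simp add: null_sets_def measure_def)
qed

section \<open>The past of an invariant subalgebra, innovations and their energy\<close>

locale invariant_subalgebra = measure_preserving_system +
  fixes F :: "'a measure"
  assumes subalg: "subalgebra M F" and map_F: "\<phi> \<in> measurable F F"
begin

text \<open>If the iterate \<open>k\<close> is read as time \<open>-k\<close>, this is the part of
  \<open>F\<close> strictly before the present. It may be a proper part, and an innovation measures
  what is missing.\<close>

definition past :: "'a measure" where
  "past = vimage_algebra (space M) \<phi> F"

lemma space_F: "space F = space M" and sets_F: "sets F \<subseteq> sets M"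
  using subalg by (auto simp: subalgebra_def)

lemma map_space: "\<phi> \<in> space M \<rightarrow> space F"
  using measurable_space[OF measurable_map] by (simp add: space_F)

lemma sets_past: "sets past = {\<phi> -` B \<inter> space M | B. B \<in> sets F}"
  unfolding past_def by (rule sets_vimage_algebra2[OF map_space])

lemma sets_past_le: "sets past \<subseteq> sets F"
  using measurable_sets[OF map_F] by (auto simp: sets_past space_F)

lemma subalg_past: "subalgebra M past"
  using sets_past_le sets_F by (auto simp: subalgebra_def past_def)

sublocale past: finite_measure_subalgebra M past
  by (rule finite_measure_subalgebra.intro) (unfold_locales, rule subalg_past)

lemma map_past: "\<phi> \<in> measurable past F"
  unfolding past_def by (rule measurable_vimage_algebra1[OF map_space])

lemma funpow_F: "(\<phi> ^^ k) \<in> measurable F F"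
proof (induction k)
  case (Suc k)
  then show ?case using measurable_comp[OF Suc map_F] by (simp add: comp_def)
qed (simp add: measurable_ident[unfolded id_def] id_def)

text \<open>The exponent is a successor because only the zeroth iterate sees the present. An
  \<open>F\<close>-measurable function composed with any other iterate is a function of the
  past.\<close>

lemma funpow_past: "(\<phi> ^^ Suc k) \<in> measurable past F"
  using measurable_comp[OF map_past funpow_F[of k]] by (simp add: funpow_Suc_right del: funpow.simps(2))

definition innovation :: "'a set \<Rightarrow> 'a \<Rightarrow> real" where
  "innovation A x = indicator A x - real_cond_exp M past (indicator A) x"

context
  fixes A assumes A: "A \<in> sets F"
begin

lemma A_M: "A \<in> sets M" using A sets_F by blast

lemma cond_exp_bounds: "AE x in M. 0 \<le> real_cond_exp M past (indicator A) x"
  "AE x in M. real_cond_exp M past (indicator A) x \<le> 1"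
  using A_M by (intro past.real_cond_exp_ge_c past.real_cond_exp_le_c; simp add: less_top[symmetric] split: split_indicator)+

lemma innovation_F: "innovation A \<in> borel_measurable F"
proof -
  have "real_cond_exp M past (indicator A) \<in> borel_measurable F"
    by (rule measurable_from_subalg[OF _ borel_measurable_cond_exp])
      (use sets_past_le in \<open>simp add: subalgebra_def past_def space_F\<close>)
  then show ?thesis unfolding innovation_def[abs_def] using A by measurable
qed

lemma innovation_M: "innovation A \<in> borel_measurable M"
  by (rule measurable_from_subalg[OF subalg innovation_F])

lemma AE_innovation_bounded: "AE x in M. \<bar>innovation A x\<bar> \<le> 1"
  using cond_exp_bounds by eventually_elim (auto simp: innovation_def split: split_indicator)

lemma innovation_sq: "square_integrable M (innovation A)"
  by (rule AE_bounded_square_integrable[OF innovation_M AE_innovation_bounded])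

lemma innovation_orthogonal:
  assumes g: "g \<in> borel_measurable past" "square_integrable M g"
  shows "(LINT x|M. g x * innovation A x) = 0"
proof -
  note [measurable] = A_M
  have "square_integrable M (indicator A :: 'a \<Rightarrow> real)"
    by (rule AE_bounded_square_integrable) (auto split: split_indicator)
  then have int: "integrable M (\<lambda>x. g x * indicator A x)"
    by (rule integrable_mult_square_integrable[OF g(2)])
  note ce = past.real_cond_exp_intg[OF int g(1)]
  have "(LINT x|M. g x * innovation A x) =
      (LINT x|M. g x * indicator A x - g x * real_cond_exp M past (indicator A) x)"
    by (simp add: innovation_def right_diff_distrib)
  also have "\<dots> = 0" using int ce by simp
  finally show ?thesis .
qed

text \<open>This is the value at \<open>B\<close> of the measure with density
  \<open>(innovation A)\<^sup>2\<close>.\<close>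

definition energy :: "'a set \<Rightarrow> real" where
  "energy B = (LINT x|M. indicator B x * (innovation A x)\<^sup>2)"

lemma integrable_energy: "B \<in> sets M \<Longrightarrow> integrable M (\<lambda>x. indicator B x * (innovation A x)\<^sup>2)"
  using integrable_real_mult_indicator[of B M "\<lambda>x. (innovation A x)\<^sup>2"] innovation_sq
  by (simp add: square_integrable_def mult.commute)

lemma energy_nonneg: "energy B \<ge> 0"
  unfolding energy_def by (intro Bochner_Integration.integral_nonneg) simp

lemma energy_Diff:
  assumes "B \<in> sets M" "C \<in> sets M" "C \<subseteq> B"
  shows "energy (B - C) = energy B - energy C"
proof -
  have "energy B - energy C = (LINT x|M. indicator B x * (innovation A x)\<^sup>2 - indicator C x * (innovation A x)\<^sup>2)"
    unfolding energy_def using assms by (intro Bochner_Integration.integral_diff[symmetric] integrable_energy)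
  also have "\<dots> = energy (B - C)"
    unfolding energy_def using assms(3) by (intro Bochner_Integration.integral_cong) (auto split: split_indicator)
  finally show ?thesis by simp
qed

lemma energy_mono:
  assumes "B \<in> sets M" "C \<in> sets M" "C \<subseteq> B"
  shows "energy C \<le> energy B"
  using energy_Diff[OF assms] energy_nonneg[of "B - C"] by simp

text \<open>On \<open>D\<close> the indicator of \<open>A\<close> is almost surely constant, so the
  innovation agrees there with a function of the past. Being orthogonal to such functions, it is
  orthogonal to its own restriction to \<open>D\<close>, which therefore has norm 0.\<close>

lemma energy_zero:
  assumes D: "D \<in> sets past" and triv: "measure M (D \<inter> A) = 0 \<or> measure M (D - A) = 0"
  shows "energy D = 0"
proof -
  have DM [measurable]: "D \<in> sets M" using D sets_past_le sets_F by blast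
  note [measurable] = A_M innovation_M
  have "\<exists>c\<in>{0, 1}. AE x in M. indicator D x * indicator A x = c * (indicator D x :: real)"
    using triv
  proof
    assume "measure M (D \<inter> A) = 0"
    then have "AE x in M. x \<notin> D \<inter> A"
      by (intro AE_not_in) (simp add: null_sets_def emeasure_eq_measure)
    then show ?thesis by (intro bexI[of _ 0]) (auto elim: eventually_mono split: split_indicator)
  next
    assume "measure M (D - A) = 0"
    then have "AE x in M. x \<notin> D - A"
      by (intro AE_not_in) (simp add: null_sets_def emeasure_eq_measure)
    then show ?thesis by (intro bexI[of _ 1]) (auto elim: eventually_mono split: split_indicator)
  qed
  then obtain c :: real where c: "c \<in> {0, 1}" "AE x in M. indicator D x * indicator A x = c * (indicator D x :: real)"
    by blast
  \<comment> \<open>The restriction of the innovation to \<open>D\<close>, up to a null set. As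
    \<open>c\<close> is 0 or 1, it is almost surely bounded by 1, hence square integrable.\<close>
  define g where "g x = indicator D x * (c - real_cond_exp M past (indicator A) x)" for x
  have g_past: "g \<in> borel_measurable past" unfolding g_def[abs_def] using D by measurable
  then have gM: "g \<in> borel_measurable M" by (rule measurable_from_subalg[OF subalg_past])
  have "AE x in M. \<bar>g x\<bar> \<le> 1"
    using cond_exp_bounds by eventually_elim (use c(1) in \<open>auto simp: g_def split: split_indicator\<close>)
  then have "(LINT x|M. g x * innovation A x) = 0"
    by (intro innovation_orthogonal g_past AE_bounded_square_integrable gM)
  moreover have "energy D = (LINT x|M. g x * innovation A x)"
    unfolding energy_def
  proof (rule integral_cong_AE)
    show "AE x in M. indicator D x * (innovation A x)\<^sup>2 = g x * innovation A x"
      using c(2)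
    proof eventually_elim
      case (elim x)
      then have "indicator D x * innovation A x = g x"
        by (simp add: innovation_def g_def algebra_simps)
      then show ?case by (simp add: power2_eq_square flip: mult.assoc)
    qed
  qed (use gM in measurable)
  ultimately show ?thesis by simp
qed

end

text \<open>Write \<open>D = \<phi>\<inverse> D'\<close> with an atom \<open>D'\<close> of \<open>F\<close>. By recurrence \<open>D'\<close> is almost equal to some
  \<open>\<phi>\<^sup>-\<^sup>p D'\<close>, \<open>p \<ge> 1\<close>, which is the preimage of \<open>D\<close> under \<open>\<phi>\<^sup>p\<^sup>-\<^sup>1\<close>; so a splitting of \<open>D\<close> in \<open>F\<close> would
  split \<open>D'\<close>.\<close>

lemma atom_trivial:
  assumes D: "D \<in> sets past" "measure M D > 0"
    and atom: "\<And>C. C \<in> sets past \<Longrightarrow> measure M (D \<inter> C) = 0 \<or> measure M (D - C) = 0"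
    and A: "A \<in> sets F"
  shows "measure M (D \<inter> A) = 0 \<or> measure M (D - A) = 0"
proof -
  obtain D' where D': "D' \<in> sets F" "D = \<phi> -` D' \<inter> space M" using D(1) by (auto simp: sets_past)
  have D'M: "D' \<in> sets M" using D'(1) sets_F by blast
  \<comment> \<open>\<open>D'\<close> inherits indivisibility from \<open>D\<close>, now with
    respect to all of \<open>F\<close>, since the preimages of sets in \<open>F\<close> are exactly
    the past sets.\<close>
  have atom': "measure M (D' \<inter> C) = 0 \<or> measure M (D' - C) = 0" if C: "C \<in> sets F" for C
  proof -
    have CM: "C \<in> sets M" using C sets_F by blast
    have "\<phi> -` (D' \<inter> C) \<inter> space M = D \<inter> (\<phi> -` C \<inter> space M)"
      "\<phi> -` (D' - C) \<inter> space M = D - (\<phi> -` C \<inter> space M)" by (auto simp: D'(2))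
    then have "measure M (D' \<inter> C) = measure M (D \<inter> (\<phi> -` C \<inter> space M))"
      "measure M (D' - C) = measure M (D - (\<phi> -` C \<inter> space M))"
      using measure_preserving[of "D' \<inter> C"] measure_preserving[of "D' - C"] D'M CM by auto
    then show ?thesis using atom[of "\<phi> -` C \<inter> space M"] C by (auto simp: sets_past)
  qed
  have mD: "measure M D' = measure M D" using measure_preserving[OF D'M] by (simp add: D'(2))
  have mD': "measure M D' > 0" using D(2) mD by simp
  obtain p where p: "p \<ge> 1" "measure M (D' \<inter> ((\<phi> ^^ p) -` D' \<inter> space M)) > 0"
    using poincare_recurrence[OF D'M mD'] by (elim exE conjE)
  define k where "k = p - 1"
  have k: "p = Suc k" using p(1) by (simp add: k_def)
  note measurable_k = measure_preserving_system.measurable_map[OF measure_preserving_system_funpow[of k]]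
  note preserving = measure_preserving_system.measure_preserving[OF measure_preserving_system_funpow]
  let ?D = "(\<phi> ^^ p) -` D' \<inter> space M"
  have DF: "?D \<in> sets F" using measurable_sets[OF funpow_F[of p] D'(1)] by (simp add: space_F)
  have DM: "?D \<in> sets M" using DF sets_F by blast
  \<comment> \<open>\<open>D'\<close> meets \<open>?D\<close> in positive measure, so almost all of
    it lies in \<open>?D\<close>; equal measures give the other inclusion.\<close>
  have "measure M (D' - ?D) = 0" using atom'[OF DF] p(2) by auto
  then have "measure M (D' \<inter> ?D) = measure M D'"
    using finite_measure_Diff'[OF D'M DM] by simp
  then have null: "measure M (?D - D') = 0"
    using finite_measure_Diff'[OF DM D'M] preserving[OF D'M, of p] by (simp add: Int_commute)
  have Dk: "(\<phi> ^^ k) -` D \<inter> space M = ?D"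
    using measurable_space[OF measurable_k] by (auto simp: D'(2) k)
  \<comment> \<open>Pulling \<open>D \<inter> C\<close> back along \<open>\<phi> ^^ k\<close> keeps
    its measure and lands, up to the null set \<open>?D - D'\<close>, inside \<open>D'\<close>. So
    whatever is decided about a preimage on \<open>D'\<close> is decided on
    \<open>D\<close>.\<close>
  have transfer: "measure M (D \<inter> C) = 0" if C: "C \<in> sets F" and z: "measure M (D' \<inter> ((\<phi> ^^ k) -` C \<inter> space M)) = 0" for C
  proof -
    have CM: "C \<in> sets M" "(\<phi> ^^ k) -` C \<inter> space M \<in> sets M"
      using C sets_F measurable_sets[OF measurable_k] by auto
    have DM': "D \<in> sets M" using D(1) sets_past_le sets_F by blast
    have "measure M (D \<inter> C) = measure M ((\<phi> ^^ k) -` (D \<inter> C) \<inter> space M)"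
      using preserving[of "D \<inter> C" k] DM' CM by simp
    also have "\<dots> \<le> measure M ((?D - D') \<union> (D' \<inter> ((\<phi> ^^ k) -` C \<inter> space M)))"
      using Dk DM D'M CM by (intro finite_measure_mono) auto
    also have "\<dots> \<le> measure M (?D - D') + measure M (D' \<inter> ((\<phi> ^^ k) -` C \<inter> space M))"
      using DM D'M CM by (intro measure_Un_le) auto
    finally show ?thesis using null z measure_nonneg[of M "D \<inter> C"] by simp
  qed
  have kA: "(\<phi> ^^ k) -` A \<inter> space M \<in> sets F" using measurable_sets[OF funpow_F[of k] A] by (simp add: space_F)
  have compl: "space M - A \<in> sets F" using A sets.compl_sets[of A F] by (simp add: space_F)
  have "D - A = D \<inter> (space M - A)" by (auto simp: D'(2))
  moreover have "D' - ((\<phi> ^^ k) -` A \<inter> space M) = D' \<inter> ((\<phi> ^^ k) -` (space M - A) \<inter> space M)"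
    using measurable_space[OF measurable_k] sets.sets_into_space[OF D'M] by auto
  ultimately show ?thesis
    using atom'[OF kA] transfer[OF A] transfer[OF compl] by auto
qed

section \<open>Absence of atoms and the orthonormal orbits\<close>

context
  fixes A assumes A: "A \<in> sets F"
begin

text \<open>Suppose \<open>B\<close> cannot be split. On past sets the energy has a density
  \<open>g\<close>, and where \<open>g\<close> is positive the energy and \<open>M\<close> have the
  same null past sets; so this part of \<open>B\<close> is an atom of \<open>M\<close> on
  \<open>past\<close>. Such an atom is not split by \<open>A\<close>, and its energy
  vanishes.\<close>

lemma innovation_nonatomic:
  assumes B: "B \<in> sets past" "energy A B > 0"
  shows "\<exists>C\<in>sets past. C \<subseteq> B \<and> energy A C > 0 \<and> energy A (B - C) > 0"
proof (rule ccontr)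
  assume "\<not> ?thesis"
  then have atom: "energy A C = 0 \<or> energy A (B - C) = 0" if "C \<in> sets past" "C \<subseteq> B" for C
    using that energy_nonneg[OF A] by (metis less_le)
  have pM: "C \<in> sets M" if "C \<in> sets past" for C using that sets_past_le sets_F by blast
  \<comment> \<open>The squared innovation need not be measurable over \<open>past\<close>; its
    conditional expectation is, and has the same integrals over past sets.\<close>
  define g where "g = real_cond_exp M past (\<lambda>x. (innovation A x)\<^sup>2)"
  have g_past [measurable]: "g \<in> borel_measurable past" unfolding g_def by simp
  have gM [measurable]: "g \<in> borel_measurable M" unfolding g_def by simp
  have energy_g: "energy A C = (LINT x|M. indicator C x * g x)"
    and int_g: "integrable M (\<lambda>x. indicator C x * g x)" if C: "C \<in> sets past" for C
  proof -
    have "(indicator C :: 'a \<Rightarrow> real) \<in> borel_measurable past" using C by simp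
    note ce = past.real_cond_exp_intg[OF integrable_energy[OF A pM[OF C]] this]
    show "energy A C = (LINT x|M. indicator C x * g x)" "integrable M (\<lambda>x. indicator C x * g x)"
      unfolding energy_def[OF A] g_def using ce innovation_M[OF A] by simp_all
  qed
  define D where "D = B \<inter> {x \<in> space past. g x > 0}"
  have "{x \<in> space past. g x > 0} \<in> sets past" by measurable
  then have D: "D \<in> sets past" unfolding D_def using B(1) by (rule sets.Int[rotated])
  have "energy A (B - D) \<le> 0"
  proof -
    have "0 \<le> (LINT x|M. - (indicator (B - D) x * g x))"
      by (rule Bochner_Integration.integral_nonneg) (auto simp: D_def past_def split: split_indicator)
    then show ?thesis unfolding energy_g[OF sets.Diff[OF B(1) D]] by simp
  qed
  then have eD: "energy A D = energy A B"
    using energy_Diff[OF A pM[OF B(1)] pM[OF D]] energy_nonneg[OF A, of "B - D"] by (simp add: D_def)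
  have null: "measure M C = 0" if C: "C \<in> sets past" "C \<subseteq> D" and z: "energy A C = 0" for C
  proof -
    have "AE x in M. indicator C x * g x = 0"
      using z integral_nonneg_eq_0_iff_AE[OF int_g[OF C(1)]] C(2)
      by (simp add: energy_g[OF C(1)] D_def split: split_indicator) (auto simp: indicator_def less_imp_le subset_iff)
    then have "AE x in M. x \<notin> C"
      by eventually_elim (use C(2) in \<open>auto simp: D_def split: split_indicator_asm\<close>)
    then have "C \<in> null_sets M" using AE_iff_null_sets[OF pM[OF C(1)]] by simp
    then show ?thesis by (rule measure_eq_0_null_sets)
  qed
  have mD: "measure M D > 0"
  proof (rule ccontr)
    assume "\<not> measure M D > 0"
    then have "measure M D = 0" using measure_nonneg[of M D] by linarith
    then have "AE x in M. x \<notin> D"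
      using pM[OF D] by (intro AE_not_in) (simp add: null_sets_def emeasure_eq_measure)
    then have "AE x in M. indicator D x * g x = 0"
      by eventually_elim simp
    then have "energy A D = 0" unfolding energy_g[OF D] by (rule integral_eq_zero_AE)
    then show False using eD B(2) by simp
  qed
  have "measure M (D \<inter> C) = 0 \<or> measure M (D - C) = 0" if C: "C \<in> sets past" for C
  proof -
    have DC: "D \<inter> C \<in> sets past" "D - C \<in> sets past" using D C by auto
    have "energy A (D \<inter> C) = 0 \<or> energy A (B - D \<inter> C) = 0"
      using atom[OF DC(1)] by (auto simp: D_def)
    then show ?thesis
    proof
      assume "energy A (D \<inter> C) = 0"
      then show ?thesis using null[OF DC(1)] by auto
    next
      assume "energy A (B - D \<inter> C) = 0"
      moreover have "energy A (D - C) \<le> energy A (B - D \<inter> C)"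
        using pM[OF DC(1)] pM[OF DC(2)] pM[OF B(1)] by (intro energy_mono[OF A]) (auto simp: D_def)
      ultimately have "energy A (D - C) = 0" using energy_nonneg[OF A, of "D - C"] by simp
      then show ?thesis using null[OF DC(2)] by auto
    qed
  qed
  from atom_trivial[OF D mD this A] have "energy A D = 0"
    by (rule energy_zero[OF A D])
  then show False using eD B(2) by simp
qed

text \<open>Each step splits only the set with index 0, which always exists because
  \<open>{..K}\<close> is nonempty.\<close>

lemma disjoint_past_sets:
  assumes "energy A (space M) > 0"
  shows "\<exists>B. (\<forall>i\<le>K. B i \<in> sets past \<and> energy A (B i) > 0) \<and> disjoint_family_on B {..K::nat}"
proof (induction K)
  case 0
  have "space M \<in> sets past" using sets.top[of past] by (simp add: past_def)
  then show ?case using assms by (intro exI[of _ "\<lambda>_. space M"]) (simp add: disjoint_family_on_def)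
next
  case (Suc K)
  then obtain B where B: "\<And>i. i \<le> K \<Longrightarrow> B i \<in> sets past" "\<And>i. i \<le> K \<Longrightarrow> energy A (B i) > 0"
    and disj: "\<And>i j. i \<le> K \<Longrightarrow> j \<le> K \<Longrightarrow> i \<noteq> j \<Longrightarrow> B i \<inter> B j = {}"
    unfolding disjoint_family_on_def atMost_iff by blast
  obtain C where C: "C \<in> sets past" "C \<subseteq> B 0" "energy A C > 0" "energy A (B 0 - C) > 0"
    using innovation_nonatomic[of "B 0"] B by auto
  let ?B = "B(0 := C, Suc K := B 0 - C)"
  have "?B i \<inter> ?B j = {}" if "i \<le> Suc K" "j \<le> Suc K" "i \<noteq> j" for i j
    using that C(2) disj[of i j] disj[of 0 j] disj[of i 0] by (auto simp: le_Suc_eq)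
  moreover have "?B i \<in> sets past \<and> energy A (?B i) > 0" if "i \<le> Suc K" for i
    using that B C by (auto simp: le_Suc_eq)
  ultimately show ?case
    by (intro exI[of _ ?B]) (simp add: disjoint_family_on_def)
qed

text \<open>For equal exponents the vectors are orthogonal because the sets \<open>B i\<close> are
  disjoint. For different exponents invariance moves the smaller one to 0; the other vector is then
  a function of the past, and so is its product with \<open>indicator (B i)\<close>, while the
  remaining factor is the innovation.\<close>

lemma orthonormal_innovation_orbits:
  assumes nondet: "\<not> (AE x in M. indicator A x = real_cond_exp M past (indicator A) x)"
  shows "\<exists>e :: nat \<Rightarrow> 'a \<Rightarrow> real. orthonormal_family M (UNIV \<times> {..<K}) (\<lambda>(k, i). e i \<circ> (\<phi> ^^ k))"
proof -
  have "energy A (space M) \<noteq> 0"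
  proof
    assume "energy A (space M) = 0"
    moreover have "energy A (space M) = (LINT x|M. (innovation A x)\<^sup>2)"
      unfolding energy_def[OF A] by (intro Bochner_Integration.integral_cong) auto
    ultimately have "AE x in M. (innovation A x)\<^sup>2 = 0"
      using integral_nonneg_eq_0_iff_AE[of M "\<lambda>x. (innovation A x)\<^sup>2"] innovation_sq[OF A]
      by (simp add: square_integrable_def)
    then have "AE x in M. indicator A x = real_cond_exp M past (indicator A) x"
      by eventually_elim (simp add: innovation_def)
    then show False using nondet by simp
  qed
  then have pos: "energy A (space M) > 0" using energy_nonneg[OF A, of "space M"] by linarith
  obtain B where B: "\<And>i. i \<le> K \<Longrightarrow> B i \<in> sets past" "\<And>i. i \<le> K \<Longrightarrow> energy A (B i) > 0"
    and disj: "\<And>i j. i \<le> K \<Longrightarrow> j \<le> K \<Longrightarrow> i \<noteq> j \<Longrightarrow> B i \<inter> B j = {}"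
    using disjoint_past_sets[OF pos, of K] unfolding disjoint_family_on_def atMost_iff by blast
  have pM: "C \<in> sets M" if "C \<in> sets past" for C using that sets_past_le sets_F by blast
  \<comment> \<open>Normalisation: the innovation cut to \<open>B i\<close> has the energy of
    \<open>B i\<close> as its squared norm.\<close>
  define c where "c i = 1 / sqrt (energy A (B i))" for i
  define e where "e i x = c i * (indicator (B i) x * innovation A x)" for i x
  have c: "(c i)\<^sup>2 * energy A (B i) = 1" if "i < K" for i
    using B(2)[of i] that by (simp add: c_def power_divide)
  have eF: "e i \<in> borel_measurable F" if "i < K" for i
  proof -
    have [measurable]: "B i \<in> sets F" "innovation A \<in> borel_measurable F"
      using B(1)[of i] that sets_past_le innovation_F[OF A] by auto
    show ?thesis unfolding e_def[abs_def] by measurable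
  qed
  have sqB: "square_integrable M (\<lambda>x. indicator (B i) x * innovation A x)" if "i < K" for i
  proof (rule AE_bounded_square_integrable)
    show "(\<lambda>x. indicator (B i) x * innovation A x) \<in> borel_measurable M"
      by (intro borel_measurable_times borel_measurable_indicator innovation_M[OF A] pM B(1) less_imp_le that)
    show "AE x in M. \<bar>indicator (B i) x * innovation A x\<bar> \<le> 1"
      using AE_innovation_bounded[OF A] by eventually_elim (simp split: split_indicator)
  qed
  have sqe: "square_integrable M (e i)" if "i < K" for i
    unfolding e_def[abs_def] by (rule square_integrable_mult[OF sqB[OF that]])
  have sqek: "square_integrable M (e i \<circ> (\<phi> ^^ k))" if "i < K" for i k
    using measure_preserving_system_funpow[of k] sqe[OF that] by (rule measure_preserving_system.square_integrable_comp)
  have same: "(LINT x|M. e i x * e j x) = (if i = j then 1 else 0)" if "i < K" "j < K" for i j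
  proof (cases "i = j")
    case True
    have "(LINT x|M. e i x * e i x) = (LINT x|M. (c i)\<^sup>2 * (indicator (B i) x * (innovation A x)\<^sup>2))"
      by (intro Bochner_Integration.integral_cong) (auto simp: e_def power2_eq_square split: split_indicator)
    also have "\<dots> = 1" using c[OF that(1)] by (simp add: energy_def[OF A])
    finally show ?thesis using True by simp
  next
    case False
    then have "e i x * e j x = 0" for x
      using disj[of i j] that by (auto simp: e_def split: split_indicator)
    then have "(\<lambda>x. e i x * e j x) = (\<lambda>_. 0)" by (rule ext)
    then show ?thesis using False by (simp only: integral_zero if_False)
  qed
  have cross: "(LINT x|M. e i x * e j ((\<phi> ^^ Suc p) x)) = 0" if "i < K" "j < K" for i j p
  proof -
    \<comment> \<open>The integrand is regrouped as a function of the past times the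
      innovation.\<close>
    define g where "g x = c i * (indicator (B i) x * e j ((\<phi> ^^ Suc p) x))" for x
    have ep: "(\<lambda>x. e j ((\<phi> ^^ Suc p) x)) \<in> borel_measurable past"
      by (rule measurable_compose[OF funpow_past eF[OF that(2)]])
    have gp: "g \<in> borel_measurable past"
      unfolding g_def[abs_def]
      by (intro borel_measurable_times borel_measurable_indicator borel_measurable_const ep B(1) less_imp_le that)
    have prodM: "(\<lambda>x. indicator (B i) x * e j ((\<phi> ^^ Suc p) x)) \<in> borel_measurable M"
      by (intro borel_measurable_times borel_measurable_indicator measurable_from_subalg[OF subalg_past ep]
          pM B(1) less_imp_le that)
    have "integrable M (\<lambda>x. (norm (indicator (B i) x * e j ((\<phi> ^^ Suc p) x)))\<^sup>2)"
    proof (rule Bochner_Integration.integrable_bound)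
      show "integrable M (\<lambda>x. (norm ((e j \<circ> (\<phi> ^^ Suc p)) x))\<^sup>2)"
        using sqek[OF that(2), of "Suc p"] unfolding square_integrable_def by blast
      show "(\<lambda>x. (norm (indicator (B i) x * e j ((\<phi> ^^ Suc p) x)))\<^sup>2) \<in> borel_measurable M"
        using prodM by measurable
    qed (auto split: split_indicator)
    then have "square_integrable M (\<lambda>x. indicator (B i) x * e j ((\<phi> ^^ Suc p) x))"
      unfolding square_integrable_def using prodM by blast
    then have "square_integrable M g" unfolding g_def[abs_def] by (rule square_integrable_mult)
    from innovation_orthogonal[OF A gp this] show ?thesis
      by (simp add: g_def e_def mult_ac)
  qed
  have shift: "(LINT x|M. e i ((\<phi> ^^ k) x) * e j ((\<phi> ^^ (k + p)) x)) = (LINT x|M. e i x * e j ((\<phi> ^^ p) x))"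
    if "i < K" "j < K" for i j k p
  proof -
    have "(\<lambda>x. e i x * e j ((\<phi> ^^ p) x)) \<in> borel_measurable M"
      using sqe[OF that(1)] sqek[OF that(2), of p] by (auto simp: square_integrable_def comp_def)
    from measure_preserving_system.integral_comp[OF measure_preserving_system_funpow this, of k] show ?thesis
      by (simp add: funpow_add add.commute[of k p])
  qed
  have "(LINT x|M. e i ((\<phi> ^^ k) x) * e j ((\<phi> ^^ l) x)) = (if k = l \<and> i = j then 1 else 0)"
    if "i < K" "j < K" for i j k l
  proof -
    consider "k = l" | p where "l = k + Suc p" | p where "k = l + Suc p"
      by (metis less_imp_Suc_add linorder_neqE_nat add_Suc_right)
    then show ?thesis
    proof cases
      case 1
      then show ?thesis using shift[OF that, of k 0] same[OF that] by simp
    next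
      case 2
      then show ?thesis using shift[OF that, of k "Suc p"] cross[OF that] by simp
    next
      case 3
      then show ?thesis using shift[OF that(2,1), of l "Suc p"] cross[OF that(2,1)] by (simp add: mult.commute)
    qed
  qed
  then have "orthonormal_family M (UNIV \<times> {..<K}) (\<lambda>(k, i). e i \<circ> (\<phi> ^^ k))"
    unfolding orthonormal_family_def using sqek by auto
  then show ?thesis by blast
qed

end

end

section \<open>Entropy and determinism\<close>

text \<open>The sets that can be approximated from the algebra are closed under complements, which
  leave the symmetric difference unchanged, and under countable unions, which are first
  truncated.\<close>

lemma sigma_sets_approximation:
  assumes "finite_measure M" and G: "G \<subseteq> \<A>" and \<A>: "\<A> \<subseteq> sets M" and alg: "Sigma_Algebra.algebra (space M) \<A>"
    and B: "B \<in> sigma_sets (space M) G" and \<epsilon>: "\<epsilon> > 0"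
  shows "\<exists>D\<in>\<A>. measure M ((B - D) \<union> (D - B)) < \<epsilon>"
proof -
  interpret finite_measure M by fact
  interpret \<A>: Sigma_Algebra.algebra "space M" \<A> by fact
  have GM: "sigma_sets (space M) G \<subseteq> sets M"
    using G \<A> by (intro sets.sigma_sets_subset) auto
  show ?thesis
    using B \<epsilon>
  proof (induction arbitrary: \<epsilon>)
    case (Basic B)
    then show ?case using G by (intro bexI[of _ B]) auto
  next
    case Empty
    then show ?case by (intro bexI[of _ "{}"]) auto
  next
    case (Compl B)
    then obtain D where D: "D \<in> \<A>" "measure M ((B - D) \<union> (D - B)) < \<epsilon>" by blast
    have "B \<subseteq> space M" using Compl.hyps GM sets.sets_into_space by blast
    moreover have "D \<subseteq> space M" using D(1) \<A> sets.sets_into_space by blast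
    ultimately have "((space M - B) - (space M - D)) \<union> ((space M - D) - (space M - B)) = (B - D) \<union> (D - B)" by auto
    then show ?case using D by (intro bexI[of _ "space M - D"]) auto
  next
    case (Union B)
    have BM: "B i \<in> sets M" for i using Union.hyps GM by blast
    have \<epsilon>2: "\<epsilon> / 2 > 0" using Union.prems by simp
    have "(\<lambda>N. measure M (\<Union>i\<le>N. B i)) \<longlonglongrightarrow> measure M (\<Union>N. \<Union>i\<le>N. B i)"
      using BM by (intro finite_Lim_measure_incseq) (auto simp: incseq_def intro: le_trans)
    moreover have U: "(\<Union>N. \<Union>i\<le>N. B i) = (\<Union>i. B i)" by blast
    ultimately have "eventually (\<lambda>N. measure M (\<Union>i. B i) - \<epsilon> / 2 < measure M (\<Union>i\<le>N. B i)) sequentially"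
      using \<epsilon>2 by (intro order_tendstoD) auto
    then obtain N where "measure M (\<Union>i. B i) - \<epsilon> / 2 < measure M (\<Union>i\<le>N. B i)"
      unfolding eventually_sequentially by blast
    then have N: "measure M (\<Union>i. B i) - measure M (\<Union>i\<le>N. B i) < \<epsilon> / 2" by simp
    \<comment> \<open>Half of the error goes to the tail beyond \<open>N\<close>; the other half is
      shared by the \<open>N + 1\<close> sets that are kept.\<close>
    have "\<exists>D\<in>\<A>. measure M ((B i - D) \<union> (D - B i)) < \<epsilon> / (2 * real (Suc N))" for i
      using Union.prems by (intro Union.IH) simp
    then obtain D where D: "\<And>i. D i \<in> \<A>" "\<And>i. measure M ((B i - D i) \<union> (D i - B i)) < \<epsilon> / (2 * real (Suc N))"
      by metis
    have DM: "D i \<in> sets M" for i using D(1) \<A> by blast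
    let ?D = "\<Union>i\<le>N. D i"
    let ?R = "(\<Union>i. B i) - (\<Union>i\<le>N. B i)" and ?E = "\<Union>i\<le>N. (B i - D i) \<union> (D i - B i)"
    have "((\<Union>i. B i) - ?D) \<union> (?D - (\<Union>i. B i)) \<subseteq> ?R \<union> ?E" by blast
    then have "measure M (((\<Union>i. B i) - ?D) \<union> (?D - (\<Union>i. B i))) \<le> measure M (?R \<union> ?E)"
      using BM DM by (intro finite_measure_mono) auto
    also have "\<dots> \<le> measure M ?R + measure M ?E"
      using BM DM by (intro measure_Un_le) auto
    also have "measure M ?R = measure M (\<Union>i. B i) - measure M (\<Union>i\<le>N. B i)"
      using BM by (intro finite_measure_Diff) auto
    also have "measure M ?E \<le> (\<Sum>i\<le>N. measure M ((B i - D i) \<union> (D i - B i)))"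
      using BM DM by (intro measure_UNION_le) auto
    also have "\<dots> \<le> (\<Sum>i\<le>N. \<epsilon> / (2 * real (Suc N)))"
      by (intro sum_mono less_imp_le D)
    also have "\<dots> = \<epsilon> / 2" by (simp add: field_simps)
    finally have "measure M (((\<Union>i. B i) - ?D) \<union> (?D - (\<Union>i. B i))) < \<epsilon>" using N by simp
    moreover have "?D \<in> \<A>" using D(1) by (intro \<A>.finite_UN) auto
    ultimately show ?case by blast
  qed
qed

lemma neg_mult_ln_le:
  fixes p \<epsilon> :: real
  assumes p: "0 \<le> p" "p \<le> 1" and \<epsilon>: "\<epsilon> > 0"
  shows "- p * ln p \<le> \<epsilon> + p * (1 - p) / \<epsilon>"
proof (cases "p = 0")
  case False
  txt \<open>\<open>- p ln p \<le> 2 sqrt p (1 - sqrt p)\<close>, followed by AM-GM.\<close>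
  define s where "s = sqrt p"
  have s: "0 < s" "s \<le> 1" "p = s\<^sup>2" using False p by (auto simp: s_def)
  have "- ln s \<le> 1 / s - 1" using ln_le_minus_one[of "1 / s"] s by (simp add: ln_div)
  then have "s\<^sup>2 * (- ln s) \<le> s\<^sup>2 * (1 / s - 1)" by (rule mult_left_mono) simp
  then have le: "2 * (s\<^sup>2 * (- ln s)) \<le> 2 * (s\<^sup>2 * (1 / s - 1))" by (rule mult_left_mono) simp
  have "- p * ln p = 2 * (s\<^sup>2 * (- ln s))" using s by (simp add: ln_realpow)
  also note le
  also have "s\<^sup>2 * (1 / s - 1) = s * (1 - s)" using s(1) by (simp add: power2_eq_square right_diff_distrib)
  also have "2 * (s * (1 - s)) = (2 * \<epsilon> * (s * (1 - s))) / \<epsilon>" using \<epsilon> by simp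
  also have "\<dots> \<le> (\<epsilon>\<^sup>2 + (s * (1 - s))\<^sup>2) / \<epsilon>"
    using \<epsilon> by (intro divide_right_mono sum_squares_bound) simp
  also have "\<dots> \<le> (\<epsilon>\<^sup>2 + p * (1 - p)) / \<epsilon>"
  proof -
    have "(1 - s)\<^sup>2 \<le> (1 - s) * (1 + s)"
      unfolding power2_eq_square using s by (intro mult_left_mono) auto
    then have "s\<^sup>2 * (1 - s)\<^sup>2 \<le> s\<^sup>2 * ((1 - s) * (1 + s))" by (rule mult_left_mono) simp
    moreover have "(1 - s) * (1 + s) = 1 - p" by (simp add: s(3) power2_eq_square algebra_simps)
    ultimately show ?thesis
      using \<epsilon> by (intro divide_right_mono add_left_mono) (simp_all add: s(3) power_mult_distrib)
  qed
  also have "\<dots> = \<epsilon> + p * (1 - p) / \<epsilon>" using \<epsilon> by (simp add: add_divide_distrib power2_eq_square)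
  finally show ?thesis .
qed (use \<epsilon> in simp)

text \<open>Telescoping from a fixed \<open>N\<close> on. Nonnegativity gives the lower half of the
  limit, so the increments are controlled from above only.\<close>

lemma Cesaro_zero:
  fixes H :: "nat \<Rightarrow> real"
  assumes nonneg: "\<And>n. 0 \<le> H n"
    and incr: "\<And>\<epsilon>. \<epsilon> > 0 \<Longrightarrow> \<exists>N. \<forall>n\<ge>N. H (Suc n) - H n \<le> \<epsilon>"
  shows "(\<lambda>n. H n / real n) \<longlonglongrightarrow> 0"
proof (rule order_tendstoI)
  fix c :: real assume "c < 0"
  then show "eventually (\<lambda>n. c < H n / real n) sequentially"
    using nonneg by (intro always_eventually allI) (meson divide_nonneg_nonneg less_le_trans of_nat_0_le_iff)
next
  fix c :: real assume c: "0 < c"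
  obtain N where N: "\<And>n. n \<ge> N \<Longrightarrow> H (Suc n) - H n \<le> c / 2" using incr[of "c / 2"] c by auto
  have bound: "H n \<le> H N + real (n - N) * (c / 2)" if "n \<ge> N" for n
    using that
  proof (induction n rule: dec_induct)
    case (step n)
    have "H (Suc n) \<le> H n + c / 2" using N[OF step.hyps(1)] by simp
    also have "\<dots> \<le> H N + real (n - N) * (c / 2) + c / 2" using step.IH by simp
    also have "\<dots> = H N + real (Suc n - N) * (c / 2)"
      using step.hyps(1) by (simp only: Suc_diff_le of_nat_Suc distrib_right mult_1 add.assoc add.commute[of "c / 2"])
    finally show ?case .
  qed simp
  have "(\<lambda>n. H N / real n) \<longlonglongrightarrow> 0" by (rule lim_const_over_n)
  then have "eventually (\<lambda>n. H N / real n < c / 2) sequentially"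
    using c by (intro order_tendstoD) auto
  then show "eventually (\<lambda>n. H n / real n < c) sequentially"
    \<comment> \<open>\<open>Suc N\<close> ensures both \<open>N \<le> n\<close> and a nonzero
      denominator.\<close>
    using eventually_ge_at_top[of "Suc N"]
  proof eventually_elim
    case (elim n)
    have "real (n - N) * (c / 2) \<le> real n * (c / 2)" using c by (intro mult_right_mono) auto
    then have "H n \<le> H N + real n * (c / 2)" using bound[of n] elim by simp
    then show ?case using elim by (simp add: field_simps)
  qed
qed

text \<open>In the application \<open>m\<close> is the measure of a cell, \<open>a\<close> that of
  its part in a set \<open>A\<close>, and \<open>t\<close> that of its part in the approximation
  error. With \<open>p = a / m\<close> the left side is \<open>m\<close> times
  \<open>- p * ln p\<close>. The bound is linear in \<open>m\<close> and \<open>t\<close>, so that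
  it can be summed over cells regardless of their number.\<close>

lemma conditional_entropy_term_le:
  fixes a m t \<epsilon> :: real
  assumes a: "0 \<le> a" "a \<le> m" and t: "0 \<le> t" "a \<le> t \<or> m - a \<le> t" and \<epsilon>: "\<epsilon> > 0"
  shows "- a * ln a + a * ln m \<le> \<epsilon> * m + t / \<epsilon>"
proof (cases "a = 0")
  case True
  then show ?thesis using assms by simp
next
  case False
  then have pos: "0 < a" "0 < m" using a by auto
  define p where "p = a / m"
  have p: "0 \<le> p" "p \<le> 1" "m * p = a" using pos a by (auto simp: p_def)
  have "m * (p * (1 - p)) = p * (m - m * p)" by (simp add: algebra_simps)
  also have "\<dots> = p * (m - a)" by (simp add: p(3))
  finally have eq: "m * (p * (1 - p)) = p * (m - a)" .
  \<comment> \<open>\<open>p * (m - a)\<close> is at most each of \<open>a\<close> and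
    \<open>m - a\<close>, so it does not matter which of them is bounded by
    \<open>t\<close>.\<close>
  have "p * (m - a) \<le> 1 * (m - a)" using p a by (intro mult_right_mono) auto
  moreover have "p * (m - a) \<le> p * m" using p a by (intro mult_left_mono) auto
  moreover have "p * m = a" using p(3) by (simp only: mult.commute[of p m])
  ultimately have "p * (m - a) \<le> m - a" "p * (m - a) \<le> a" by simp_all
  then have le: "m * (p * (1 - p)) \<le> t"
    unfolding eq using t(2) order_trans by blast
  have "ln p = ln a - ln m" unfolding p_def using pos by (simp add: ln_div)
  then have "- a * ln a + a * ln m = - a * ln p" by (simp add: right_diff_distrib)
  also have "\<dots> = m * (- p * ln p)" unfolding p(3)[symmetric] by (simp only: mult_minus_left mult_minus_right mult.assoc)
  also have "\<dots> \<le> m * (\<epsilon> + p * (1 - p) / \<epsilon>)"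
    using pos by (intro mult_left_mono neg_mult_ln_le p \<epsilon>) simp
  also have "\<dots> = \<epsilon> * m + m * (p * (1 - p)) / \<epsilon>" by (simp add: distrib_left mult.commute)
  also have "\<dots> \<le> \<epsilon> * m + t / \<epsilon>"
    using le \<epsilon> by (intro add_left_mono divide_right_mono) auto
  finally show ?thesis .
qed

text \<open>Unlike \<open>partition_on\<close>, this admits the empty set and is therefore stable
  under joins and preimages.\<close>

definition cell_partition :: "'a measure \<Rightarrow> 'a set set \<Rightarrow> bool" where
  "cell_partition M P \<longleftrightarrow> finite P \<and> P \<subseteq> sets M \<and> \<Union>P = space M \<and> disjoint P"

lemma cell_partition_join:
  assumes "cell_partition M P" "cell_partition M Q"
  shows "cell_partition M (partition_join P Q)"
proof -
  have "partition_join P Q = (\<lambda>(A, B). A \<inter> B) ` (P \<times> Q)" by (auto simp: partition_join_def)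
  moreover have "disjoint (partition_join P Q)"
  proof (rule disjointI)
    fix a b assume ab: "a \<in> partition_join P Q" "b \<in> partition_join P Q" "a \<noteq> b"
    then obtain A B A' B' where "a = A \<inter> B" "b = A' \<inter> B'" "A \<in> P" "A' \<in> P" "B \<in> Q" "B' \<in> Q"
      by (auto simp: partition_join_def)
    moreover from this ab(3) have "A \<noteq> A' \<or> B \<noteq> B'" by blast
    ultimately show "a \<inter> b = {}"
      using assms disjointD[of P A A'] disjointD[of Q B B'] unfolding cell_partition_def by blast
  qed
  moreover have "\<Union>(partition_join P Q) = \<Union>P \<inter> \<Union>Q" by (auto simp: partition_join_def)
  ultimately show ?thesis
    using assms by (auto simp: cell_partition_def)
qed

lemma cell_partition_vimage:
  assumes "cell_partition M P" "f \<in> measurable M M"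
  shows "cell_partition M (partition_vimage M f P)"
proof -
  have "disjoint (partition_vimage M f P)"
  proof (rule disjointI)
    fix a b assume ab: "a \<in> partition_vimage M f P" "b \<in> partition_vimage M f P" "a \<noteq> b"
    then obtain A B where "a = f -` A \<inter> space M" "b = f -` B \<inter> space M" "A \<in> P" "B \<in> P"
      by (auto simp: partition_vimage_def)
    then show "a \<inter> b = {}"
      using assms(1) ab(3) disjointD[of P A B] unfolding cell_partition_def by blast
  qed
  moreover have "\<Union>(partition_vimage M f P) = f -` \<Union>P \<inter> space M" by (auto simp: partition_vimage_def)
  moreover have "f -` space M \<inter> space M = space M" using measurable_space[OF assms(2)] by auto
  ultimately show ?thesis
    using assms measurable_sets[OF assms(2)] by (auto simp: cell_partition_def partition_vimage_def)
qed

lemma partition_vimage_join: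
  "partition_vimage M f (partition_join P Q) = partition_join (partition_vimage M f P) (partition_vimage M f Q)"
proof (intro subset_antisym subsetI)
  fix X assume "X \<in> partition_vimage M f (partition_join P Q)"
  then obtain A B where AB: "X = f -` (A \<inter> B) \<inter> space M" "A \<in> P" "B \<in> Q"
    by (auto simp: partition_vimage_def partition_join_def)
  have "X = (f -` A \<inter> space M) \<inter> (f -` B \<inter> space M)" unfolding AB(1) by blast
  then show "X \<in> partition_join (partition_vimage M f P) (partition_vimage M f Q)"
    unfolding partition_vimage_def partition_join_def using AB(2,3) by blast
next
  fix X assume "X \<in> partition_join (partition_vimage M f P) (partition_vimage M f Q)"
  then obtain A B where AB: "X = (f -` A \<inter> space M) \<inter> (f -` B \<inter> space M)" "A \<in> P" "B \<in> Q"
    by (auto simp: partition_vimage_def partition_join_def)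
  have X: "X = f -` (A \<inter> B) \<inter> space M" unfolding AB(1) by blast
  have "A \<inter> B \<in> partition_join P Q" unfolding partition_join_def using AB(2,3) by blast
  then show "X \<in> partition_vimage M f (partition_join P Q)"
    unfolding partition_vimage_def X by (rule imageI)
qed

lemma partition_join_assoc: "partition_join (partition_join P Q) R = partition_join P (partition_join Q R)"
proof (intro subset_antisym subsetI)
  fix X assume "X \<in> partition_join (partition_join P Q) R"
  then obtain A B C where "X = (A \<inter> B) \<inter> C" "A \<in> P" "B \<in> Q" "C \<in> R"
    by (auto simp: partition_join_def)
  moreover from this have "X = A \<inter> (B \<inter> C)" by (simp only: Int_assoc)
  ultimately show "X \<in> partition_join P (partition_join Q R)"
    unfolding partition_join_def by blast
next
  fix X assume "X \<in> partition_join P (partition_join Q R)"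
  then obtain A B C where "X = A \<inter> (B \<inter> C)" "A \<in> P" "B \<in> Q" "C \<in> R"
    by (auto simp: partition_join_def)
  moreover from this have "X = (A \<inter> B) \<inter> C" by (simp only: Int_assoc)
  ultimately show "X \<in> partition_join (partition_join P Q) R"
    unfolding partition_join_def by blast
qed

lemma measurable_partition_cell_partition:
  "measurable_partition M \<alpha> \<Longrightarrow> cell_partition M \<alpha>"
  by (auto simp: measurable_partition_def cell_partition_def partition_on_def)

text \<open>A null cell contributes 0 to the sum whatever the value of \<open>ln 0\<close>.\<close>

lemma partition_entropy_eq:
  assumes "finite P"
  shows "partition_entropy M P = (\<Sum>A\<in>P. - measure M A * ln (measure M A))"
  unfolding partition_entropy_def using assms by (intro sum.mono_neutral_left) auto

section \<open>Conditional entropy of finite partitions\<close>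

context prob_space
begin

lemma partition_entropy_nonneg: "0 \<le> partition_entropy M P"
  unfolding partition_entropy_def
proof (rule sum_nonneg)
  fix A assume "A \<in> {A \<in> P. measure M A \<noteq> 0}"
  then have "0 < measure M A" using measure_nonneg[of M A] by (auto simp: less_le)
  then have "ln (measure M A) \<le> 0" using prob_le_1[of A] by (simp add: ln_le_zero_iff)
  then show "0 \<le> - measure M A * ln (measure M A)" by (simp add: mult_nonneg_nonpos)
qed

lemma sum_measure_cells:
  assumes P: "cell_partition M P" and X: "X \<in> sets M"
  shows "(\<Sum>C\<in>P. measure M (C \<inter> X)) = measure M X"
proof -
  have "(\<Union>C\<in>P. C \<inter> X) = X"
    using P sets.sets_into_space[OF X] by (auto simp: cell_partition_def)
  moreover have "measure M (\<Union>C\<in>P. C \<inter> X) = (\<Sum>C\<in>P. measure M (C \<inter> X))"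
    using P X by (intro finite_measure_finite_Union)
      (auto simp: cell_partition_def disjoint_family_on_def dest: disjointD)
  ultimately show ?thesis by simp
qed

text \<open>The difference is the conditional entropy of \<open>P\<close> given \<open>Q\<close>,
  written with \<open>ln (measure M C)\<close> instead of a quotient so that null cells need no case
  distinction.\<close>

lemma partition_entropy_join:
  assumes P: "cell_partition M P" and Q: "cell_partition M Q"
  shows "partition_entropy M (partition_join P Q) - partition_entropy M Q =
    (\<Sum>A\<in>P. \<Sum>C\<in>Q. - measure M (A \<inter> C) * ln (measure M (A \<inter> C)) + measure M (A \<inter> C) * ln (measure M C))"
proof -
  let ?h = "\<lambda>A. - measure M A * ln (measure M A)"
  have fin: "finite P" "finite Q" using P Q by (auto simp: cell_partition_def)
  have join: "partition_join P Q = (\<lambda>(A, C). A \<inter> C) ` (P \<times> Q)" by (auto simp: partition_join_def)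
  have "partition_entropy M (partition_join P Q) = sum ?h ((\<lambda>(A, C). A \<inter> C) ` (P \<times> Q))"
    unfolding join using fin by (intro partition_entropy_eq) auto
  also have "\<dots> = sum (?h \<circ> (\<lambda>(A, C). A \<inter> C)) (P \<times> Q)"
  \<comment> \<open>Different pairs of cells may have the same intersection, but then it is empty
    and contributes 0.\<close>
  proof (rule sum.reindex_nontrivial)
    fix x y assume xy: "x \<in> P \<times> Q" "y \<in> P \<times> Q" "x \<noteq> y"
      and eq: "(case x of (A, C) \<Rightarrow> A \<inter> C) = (case y of (A, C) \<Rightarrow> A \<inter> C)"
    obtain A C A' C' where [simp]: "x = (A, C)" "y = (A', C')" by (cases x, cases y) auto
    have "A \<noteq> A' \<or> C \<noteq> C'" using xy(3) by auto
    then have "(A \<inter> C) \<inter> (A' \<inter> C') = {}"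
      using xy P Q disjointD[of P A A'] disjointD[of Q C C'] unfolding cell_partition_def by auto
    then have "A \<inter> C = {}" using eq by auto
    then show "?h (case x of (A, C) \<Rightarrow> A \<inter> C) = 0" by simp
  qed (use fin in simp)
  also have "\<dots> = (\<Sum>A\<in>P. \<Sum>C\<in>Q. ?h (A \<inter> C))"
    by (simp add: sum.cartesian_product case_prod_beta comp_def)
  finally have 1: "partition_entropy M (partition_join P Q) = (\<Sum>A\<in>P. \<Sum>C\<in>Q. ?h (A \<inter> C))" .
  \<comment> \<open>The factor \<open>measure M C\<close> is split along \<open>P\<close>, so that
    both entropies become sums over pairs of cells.\<close>
  have "partition_entropy M Q = (\<Sum>C\<in>Q. - (\<Sum>A\<in>P. measure M (A \<inter> C)) * ln (measure M C))"
    unfolding partition_entropy_eq[OF fin(2)]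
    using Q by (intro sum.cong refl) (auto simp: sum_measure_cells[OF P] cell_partition_def)
  also have "\<dots> = - (\<Sum>C\<in>Q. \<Sum>A\<in>P. measure M (A \<inter> C) * ln (measure M C))"
    by (simp add: sum_distrib_right sum_negf)
  also have "(\<Sum>C\<in>Q. \<Sum>A\<in>P. measure M (A \<inter> C) * ln (measure M C)) =
      (\<Sum>A\<in>P. \<Sum>C\<in>Q. measure M (A \<inter> C) * ln (measure M C))" by (rule sum.swap)
  finally have 2: "partition_entropy M Q = - (\<Sum>A\<in>P. \<Sum>C\<in>Q. measure M (A \<inter> C) * ln (measure M C))" .
  show ?thesis unfolding 1 2 by (simp only: diff_minus_eq_add sum.distrib)
qed

text \<open>A set \<open>D\<close> that cuts no cell of \<open>Q\<close> misjudges \<open>A\<close>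
  only on the symmetric difference. The tolerance \<open>\<epsilon>\<^sup>2\<close> balances the two
  terms of the estimate, \<epsilon> from the total mass and
  \<open>\<epsilon>\<^sup>2 / \<epsilon>\<close> from the error. The bound is independent of the
  number of cells of \<open>Q\<close>, which grows with the refinement.\<close>

lemma conditional_entropy_le:
  fixes \<epsilon> :: real
  assumes P: "cell_partition M P" and Q: "cell_partition M Q" and \<epsilon>: "\<epsilon> > 0"
    and approx: "\<And>A. A \<in> P \<Longrightarrow> \<exists>D\<in>sets M. (\<forall>C\<in>Q. C \<subseteq> D \<or> C \<inter> D = {}) \<and>
      measure M ((A - D) \<union> (D - A)) \<le> \<epsilon>\<^sup>2"
  shows "partition_entropy M (partition_join P Q) - partition_entropy M Q \<le> card P * (2 * \<epsilon>)"
proof -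
  have "(\<Sum>C\<in>Q. - measure M (A \<inter> C) * ln (measure M (A \<inter> C)) + measure M (A \<inter> C) * ln (measure M C)) \<le> 2 * \<epsilon>"
    if A: "A \<in> P" for A
  proof -
    obtain D where D: "D \<in> sets M" "\<forall>C\<in>Q. C \<subseteq> D \<or> C \<inter> D = {}" "measure M ((A - D) \<union> (D - A)) \<le> \<epsilon>\<^sup>2"
      using approx[OF A] by (elim bexE conjE)
    let ?X = "(A - D) \<union> (D - A)"
    have AM: "A \<in> sets M" using A P by (auto simp: cell_partition_def)
    have XM: "?X \<in> sets M" using AM D(1) by auto
    have "(\<Sum>C\<in>Q. - measure M (A \<inter> C) * ln (measure M (A \<inter> C)) + measure M (A \<inter> C) * ln (measure M C)) \<le>
        (\<Sum>C\<in>Q. \<epsilon> * measure M C + measure M (C \<inter> ?X) / \<epsilon>)"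
    proof (rule sum_mono)
      fix C assume C: "C \<in> Q"
      have CM: "C \<in> sets M" using C Q by (auto simp: cell_partition_def)
      \<comment> \<open>Within a cell inside \<open>D\<close> the error is what \<open>A\<close>
        misses; within a cell outside \<open>D\<close> it is what \<open>A\<close> contains.\<close>
      have "measure M (A \<inter> C) \<le> measure M (C \<inter> ?X) \<or> measure M C - measure M (A \<inter> C) \<le> measure M (C \<inter> ?X)"
        using D(2) C
      proof (elim ballE disjE)
        assume "C \<subseteq> D"
        then have "C \<inter> ?X = C - A" by blast
        then show ?thesis using finite_measure_Diff'[OF CM AM] by (simp add: Int_commute)
      next
        assume "C \<inter> D = {}"
        then have "C \<inter> ?X = A \<inter> C" by blast
        then show ?thesis by simp
      qed auto
      then show "- measure M (A \<inter> C) * ln (measure M (A \<inter> C)) + measure M (A \<inter> C) * ln (measure M C) \<le>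
          \<epsilon> * measure M C + measure M (C \<inter> ?X) / \<epsilon>"
        using CM by (intro conditional_entropy_term_le \<epsilon> measure_nonneg finite_measure_mono) auto
    qed
    also have "\<dots> = \<epsilon> * (\<Sum>C\<in>Q. measure M C) + (\<Sum>C\<in>Q. measure M (C \<inter> ?X)) / \<epsilon>"
      by (simp add: sum.distrib sum_distrib_left sum_divide_distrib)
    also have "(\<Sum>C\<in>Q. measure M C) = (\<Sum>C\<in>Q. measure M (C \<inter> space M))"
    proof (rule sum.cong[OF refl])
      fix C assume "C \<in> Q"
      then have "C \<in> sets M" using Q by (auto simp: cell_partition_def)
      then show "measure M C = measure M (C \<inter> space M)" by simp
    qed
    also have "\<dots> = 1" using sum_measure_cells[OF Q sets.top] by (simp add: prob_space)
    also have "(\<Sum>C\<in>Q. measure M (C \<inter> ?X)) = measure M ?X" by (rule sum_measure_cells[OF Q XM])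
    also have "\<epsilon> * 1 + measure M ?X / \<epsilon> \<le> 2 * \<epsilon>"
      using D(3) \<epsilon> by (simp add: power2_eq_square pos_divide_le_eq)
    finally show ?thesis .
  qed
  then show ?thesis
    unfolding partition_entropy_join[OF P Q] by (rule sum_bounded_above)
qed

end

section \<open>Refined partitions, the algebras of their past cells and vanishing entropy\<close>

context measure_preserving_system
begin

lemma cell_partition_refined:
  assumes "cell_partition M \<alpha>"
  shows "cell_partition M (refined_partition M \<phi> \<alpha> n)"
proof (induction n)
  case (Suc n)
  then show ?case
    using cell_partition_vimage[OF assms measure_preserving_system.measurable_map[OF measure_preserving_system_funpow]]
    by (simp add: cell_partition_join)
qed (auto simp: cell_partition_def disjoint_def)

lemma partition_vimage_funpow_Suc:
  "partition_vimage M (\<phi> ^^ Suc k) \<alpha> = partition_vimage M \<phi> (partition_vimage M (\<phi> ^^ k) \<alpha>)"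
proof -
  have "(\<phi> ^^ Suc k) -` A \<inter> space M = \<phi> -` ((\<phi> ^^ k) -` A \<inter> space M) \<inter> space M" for A
    using measurable_space[OF measurable_map] by (auto simp: funpow_Suc_right simp del: funpow.simps(2))
  then show ?thesis by (simp add: partition_vimage_def image_image)
qed

lemma partition_entropy_vimage:
  assumes P: "cell_partition M P"
  shows "partition_entropy M (partition_vimage M \<phi> P) = partition_entropy M P"
proof -
  let ?h = "\<lambda>A. - measure M A * ln (measure M A)"
  have fin: "finite P" using P by (simp add: cell_partition_def)
  have "partition_entropy M (partition_vimage M \<phi> P) = sum ?h ((\<lambda>A. \<phi> -` A \<inter> space M) ` P)"
    unfolding partition_vimage_def using fin by (intro partition_entropy_eq) simp
  also have "\<dots> = sum (?h \<circ> (\<lambda>A. \<phi> -` A \<inter> space M)) P"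
  proof (rule sum.reindex_nontrivial[OF fin])
    fix A B assume "A \<in> P" "B \<in> P" "A \<noteq> B" and eq: "\<phi> -` A \<inter> space M = \<phi> -` B \<inter> space M"
    then have "A \<inter> B = {}" using P disjointD[of P A B] by (simp add: cell_partition_def)
    then have "\<phi> -` A \<inter> space M = {}" using eq by blast
    then show "?h (\<phi> -` A \<inter> space M) = 0" by simp
  qed
  also have "\<dots> = (\<Sum>A\<in>P. ?h A)"
    using P measure_preserving by (intro sum.cong refl) (auto simp: cell_partition_def)
  also have "\<dots> = partition_entropy M P" by (rule partition_entropy_eq[OF fin, symmetric])
  finally show ?thesis .
qed

text \<open>The recursion of \<open>refined_partition\<close> appends the highest iterate; here the
  zeroth is peeled off instead. What remains is a preimage under \<phi>, which has the entropy of
  the previous step, so the entropy increment becomes a conditional entropy given the past.\<close>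

lemma refined_partition_Suc_past:
  assumes \<alpha>: "cell_partition M \<alpha>"
  shows "refined_partition M \<phi> \<alpha> (Suc n) = partition_join \<alpha> (partition_vimage M \<phi> (refined_partition M \<phi> \<alpha> n))"
proof (induction n)
  case 0
  have sub: "A \<inter> space M = A" if "A \<in> \<alpha>" for A
    using that \<alpha> sets.sets_into_space by (auto simp: cell_partition_def)
  have "partition_vimage M (\<phi> ^^ 0) \<alpha> = \<alpha>"
    using sub by (auto simp: partition_vimage_def)
  moreover have "partition_vimage M \<phi> {space M} = {space M}"
    using measurable_space[OF measurable_map] by (auto simp: partition_vimage_def)
  moreover have "partition_join {space M} \<alpha> = \<alpha>" "partition_join \<alpha> {space M} = \<alpha>"
    using sub by (auto simp: partition_join_def Int_commute)
  ultimately show ?case by simp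
next
  case (Suc n)
  let ?R = "refined_partition M \<phi> \<alpha>"
  have "?R (Suc (Suc n)) = partition_join (?R (Suc n)) (partition_vimage M (\<phi> ^^ Suc n) \<alpha>)"
    by (rule refined_partition.simps(2))
  also have "\<dots> = partition_join (partition_join \<alpha> (partition_vimage M \<phi> (?R n)))
      (partition_vimage M \<phi> (partition_vimage M (\<phi> ^^ n) \<alpha>))"
    by (simp only: Suc partition_vimage_funpow_Suc)
  also have "\<dots> = partition_join \<alpha> (partition_vimage M \<phi> (?R (Suc n)))"
    by (simp only: partition_join_assoc partition_vimage_join refined_partition.simps(2))
  finally show ?case .
qed

lemma refined_partition_cells:
  assumes "A \<in> \<alpha>" "k < n" "C \<in> refined_partition M \<phi> \<alpha> n" "disjoint \<alpha>"
  shows "C \<subseteq> (\<phi> ^^ k) -` A \<inter> space M \<or> C \<inter> ((\<phi> ^^ k) -` A \<inter> space M) = {}"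
  using assms(2,3)
proof (induction n arbitrary: C)
  case (Suc n)
  then obtain C' A' where C: "C = C' \<inter> ((\<phi> ^^ n) -` A' \<inter> space M)" "C' \<in> refined_partition M \<phi> \<alpha> n" "A' \<in> \<alpha>"
    by (auto simp: partition_join_def partition_vimage_def)
  show ?case
  proof (cases "k = n")
    case True
    have "A = A' \<or> A \<inter> A' = {}" using disjointD[OF assms(4,1) C(3)] by blast
    then show ?thesis using True C(1) by blast
  next
    case False
    then show ?thesis using Suc.IH[OF _ C(2)] Suc.prems(1) C(1) by auto
  qed
qed simp

text \<open>These are the unions of past cells of depth \<open>n\<close>, described by the cells
  they do not cut because \<open>conditional_entropy_le\<close> asks for this form.\<close>

definition cell_algebra :: "'a set set \<Rightarrow> nat \<Rightarrow> 'a set set" where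
  "cell_algebra \<alpha> n =
    {D \<in> sets M. \<forall>C\<in>partition_vimage M \<phi> (refined_partition M \<phi> \<alpha> n). C \<subseteq> D \<or> C \<inter> D = {}}"

lemma cell_algebra_mono: "m \<le> n \<Longrightarrow> cell_algebra \<alpha> m \<subseteq> cell_algebra \<alpha> n"
proof (induction n rule: dec_induct)
  case (step n)
  have "cell_algebra \<alpha> n \<subseteq> cell_algebra \<alpha> (Suc n)"
  proof
    fix D assume D: "D \<in> cell_algebra \<alpha> n"
    have "C \<subseteq> D \<or> C \<inter> D = {}"
      if C: "C \<in> partition_vimage M \<phi> (refined_partition M \<phi> \<alpha> (Suc n))" for C
    proof -
      obtain B where B: "C = \<phi> -` B \<inter> space M" "B \<in> refined_partition M \<phi> \<alpha> (Suc n)"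
        using C unfolding partition_vimage_def by blast
      obtain B' where "B \<subseteq> B'" "B' \<in> refined_partition M \<phi> \<alpha> n"
        using B(2) unfolding refined_partition.simps partition_join_def by blast
      then have "C \<subseteq> \<phi> -` B' \<inter> space M" "\<phi> -` B' \<inter> space M \<in> partition_vimage M \<phi> (refined_partition M \<phi> \<alpha> n)"
        using B(1) unfolding partition_vimage_def by blast+
      then show ?thesis using D unfolding cell_algebra_def by blast
    qed
    then show "D \<in> cell_algebra \<alpha> (Suc n)" using D by (simp add: cell_algebra_def)
  qed
  then show ?case using step.IH by blast
qed simp

text \<open>The algebras increase with \<open>n\<close>, so two members of the union lie in a common
  stage.\<close>

lemma cell_algebra_algebra:
  assumes "cell_partition M \<alpha>"
  shows "Sigma_Algebra.algebra (space M) (\<Union>n. cell_algebra \<alpha> n)"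
proof -
  have sub: "C \<subseteq> space M" if "C \<in> partition_vimage M \<phi> (refined_partition M \<phi> \<alpha> n)" for C n
    using that by (auto simp: partition_vimage_def)
  have alg: "Sigma_Algebra.algebra (space M) (cell_algebra \<alpha> n)" for n
    unfolding algebra_iff_Un
  proof (intro conjI ballI)
    show "cell_algebra \<alpha> n \<subseteq> Pow (space M)" using sets.sets_into_space by (auto simp: cell_algebra_def)
    show "{} \<in> cell_algebra \<alpha> n" by (auto simp: cell_algebra_def)
    fix a assume a: "a \<in> cell_algebra \<alpha> n"
    have aD: "C \<subseteq> a \<or> C \<inter> a = {}" if "C \<in> partition_vimage M \<phi> (refined_partition M \<phi> \<alpha> n)" for C
      using a that unfolding cell_algebra_def by blast
    have aM: "a \<in> sets M" using a by (simp add: cell_algebra_def)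
    have "C \<subseteq> space M - a \<or> C \<inter> (space M - a) = {}"
      if "C \<in> partition_vimage M \<phi> (refined_partition M \<phi> \<alpha> n)" for C
      using aD[OF that] sub[OF that] by blast
    then show "space M - a \<in> cell_algebra \<alpha> n"
      unfolding cell_algebra_def mem_Collect_eq by (intro conjI ballI sets.compl_sets aM)
    fix b assume b: "b \<in> cell_algebra \<alpha> n"
    have bD: "C \<subseteq> b \<or> C \<inter> b = {}" if "C \<in> partition_vimage M \<phi> (refined_partition M \<phi> \<alpha> n)" for C
      using b that unfolding cell_algebra_def by blast
    have bM: "b \<in> sets M" using b by (simp add: cell_algebra_def)
    have "C \<subseteq> a \<union> b \<or> C \<inter> (a \<union> b) = {}"
      if "C \<in> partition_vimage M \<phi> (refined_partition M \<phi> \<alpha> n)" for C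
      using aD[OF that] bD[OF that] by blast
    then show "a \<union> b \<in> cell_algebra \<alpha> n"
      unfolding cell_algebra_def mem_Collect_eq by (intro conjI ballI sets.Un aM bM)
  qed
  show ?thesis
    unfolding algebra_iff_Un
  proof (intro conjI ballI)
    show "(\<Union>n. cell_algebra \<alpha> n) \<subseteq> Pow (space M)" using sets.sets_into_space by (auto simp: cell_algebra_def)
    show "{} \<in> (\<Union>n. cell_algebra \<alpha> n)" by (auto simp: cell_algebra_def)
    fix a assume "a \<in> (\<Union>n. cell_algebra \<alpha> n)"
    then obtain m where m: "a \<in> cell_algebra \<alpha> m" by blast
    then show "space M - a \<in> (\<Union>n. cell_algebra \<alpha> n)"
      using alg[of m] unfolding algebra_iff_Un by blast
    fix b assume "b \<in> (\<Union>n. cell_algebra \<alpha> n)"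
    then obtain n where n: "b \<in> cell_algebra \<alpha> n" by blast
    have "a \<in> cell_algebra \<alpha> (max m n)" "b \<in> cell_algebra \<alpha> (max m n)"
      using m n cell_algebra_mono[of m "max m n"] cell_algebra_mono[of n "max m n"] by auto
    then show "a \<union> b \<in> (\<Union>n. cell_algebra \<alpha> n)"
      using alg[of "max m n"] unfolding algebra_iff_Un by blast
  qed
qed

definition cylinders :: "'a set set \<Rightarrow> 'a set set" where
  "cylinders \<alpha> = {(\<phi> ^^ k) -` A \<inter> space M | k A. A \<in> \<alpha>}"

lemma past_cylinders_cell_algebra:
  assumes \<alpha>: "cell_partition M \<alpha>" and B: "B \<in> cylinders \<alpha>"
  shows "\<phi> -` B \<inter> space M \<in> (\<Union>n. cell_algebra \<alpha> n)"
proof -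
  obtain k A where kA: "B = (\<phi> ^^ k) -` A \<inter> space M" "A \<in> \<alpha>" using B by (auto simp: cylinders_def)
  have "A \<in> sets M" using kA(2) \<alpha> by (auto simp: cell_partition_def)
  then have "B \<in> sets M"
    unfolding kA(1) using measure_preserving_system_funpow[of k]
    by (metis measurable_sets measure_preserving_system.measurable_map)
  \<comment> \<open>Depth \<open>Suc k\<close>, because \<open>refined_partition\<close> at depth
    \<open>n\<close> uses only the iterates below \<open>n\<close>.\<close>
  moreover have "C \<subseteq> \<phi> -` B \<inter> space M \<or> C \<inter> (\<phi> -` B \<inter> space M) = {}"
    if C: "C \<in> partition_vimage M \<phi> (refined_partition M \<phi> \<alpha> (Suc k))" for C
  proof -
    obtain C' where C': "C = \<phi> -` C' \<inter> space M" "C' \<in> refined_partition M \<phi> \<alpha> (Suc k)"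
      using C by (auto simp: partition_vimage_def)
    have "C' \<subseteq> B \<or> C' \<inter> B = {}"
      unfolding kA(1) using \<alpha> by (intro refined_partition_cells[OF kA(2) lessI C'(2)]) (simp add: cell_partition_def)
    then show ?thesis unfolding C'(1) by blast
  qed
  ultimately have "\<phi> -` B \<inter> space M \<in> cell_algebra \<alpha> (Suc k)"
    using measurable_sets[OF measurable_map] by (simp add: cell_algebra_def)
  then show ?thesis by blast
qed

text \<open>The preimage of a cylinder is the cylinder with exponent one larger.\<close>

lemma invariant_subalgebra_cylinders:
  assumes \<alpha>: "cell_partition M \<alpha>"
  shows "invariant_subalgebra M \<phi> (sigma (space M) (cylinders \<alpha>))"
proof
  have cyl: "cylinders \<alpha> \<subseteq> sets M"
    using \<alpha> measurable_sets[OF measure_preserving_system.measurable_map[OF measure_preserving_system_funpow]]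
    by (auto simp: cylinders_def cell_partition_def)
  then have Pow: "cylinders \<alpha> \<subseteq> Pow (space M)" using sets.sets_into_space by blast
  show "subalgebra M (sigma (space M) (cylinders \<alpha>))"
    using sets.sigma_sets_subset[OF cyl] Pow by (simp add: subalgebra_def sets_measure_of space_measure_of)
  show "\<phi> \<in> measurable (sigma (space M) (cylinders \<alpha>)) (sigma (space M) (cylinders \<alpha>))"
  proof (rule measurable_measure_of[OF Pow])
    show "\<phi> \<in> space (sigma (space M) (cylinders \<alpha>)) \<rightarrow> space M"
      using measurable_space[OF measurable_map] Pow by (simp add: space_measure_of)
    fix B assume "B \<in> cylinders \<alpha>"
    then obtain k A where kA: "B = (\<phi> ^^ k) -` A \<inter> space M" "A \<in> \<alpha>" by (auto simp: cylinders_def)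
    have "\<phi> -` B \<inter> space M = (\<phi> ^^ Suc k) -` A \<inter> space M"
      unfolding kA(1) using measurable_space[OF measurable_map]
      by (auto simp: funpow_Suc_right simp del: funpow.simps(2))
    then have "\<phi> -` B \<inter> space M \<in> cylinders \<alpha>" using kA(2) unfolding cylinders_def by blast
    then show "\<phi> -` B \<inter> space (sigma (space M) (cylinders \<alpha>)) \<in> sets (sigma (space M) (cylinders \<alpha>))"
      using Pow by (simp add: sets_measure_of space_measure_of sigma_sets.Basic)
  qed
qed

text \<open>A determined cell is almost surely a past set, and past sets are approximated by unions
  of past cells of finite depth. So the conditional entropy of \<alpha> given the past cells of
  depth \<open>n\<close> tends to 0, and these are the increments of the entropy.\<close>

lemma entropy_of_partition_eq_0:
  assumes \<alpha>: "cell_partition M \<alpha>"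
    and det: "\<And>A. A \<in> \<alpha> \<Longrightarrow> AE x in M. indicator A x = real_cond_exp M
      (invariant_subalgebra.past M \<phi> (sigma (space M) (cylinders \<alpha>))) (indicator A) x"
  shows "entropy_of_partition M \<phi> \<alpha> = 0"
proof -
  interpret I: invariant_subalgebra M \<phi> "sigma (space M) (cylinders \<alpha>)"
    by (rule invariant_subalgebra_cylinders[OF \<alpha>])
  have fin: "finite \<alpha>" and \<alpha>M: "\<alpha> \<subseteq> sets M" using \<alpha> by (auto simp: cell_partition_def)
  have cylP: "cylinders \<alpha> \<subseteq> Pow (space M)" by (auto simp: cylinders_def)
  let ?G = "{\<phi> -` B \<inter> space M | B. B \<in> cylinders \<alpha>}"
  have "I.past = sigma (space M) ?G"
    unfolding I.past_def
    by (rule vimage_algebra_sigma[OF cylP]) (use measurable_space[OF measurable_map] in auto)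
  moreover have "?G \<subseteq> Pow (space M)" by blast
  ultimately have past_sets: "sets I.past = sigma_sets (space M) ?G"
    by (simp only: sets_measure_of)
  have approx: "\<exists>D\<in>\<Union>n. cell_algebra \<alpha> n. measure M ((A - D) \<union> (D - A)) \<le> \<epsilon>"
    if A: "A \<in> \<alpha>" and \<epsilon>: "\<epsilon> > 0" for A \<epsilon>
  proof -
    let ?E = "real_cond_exp M I.past (indicator A)"
    \<comment> \<open>The conditional expectation is almost surely 0 or 1, so a threshold between
      them recovers \<open>A\<close> as a past set.\<close>
    define B where "B = {x \<in> space I.past. ?E x > 1 / 2}"
    have "B \<in> sets I.past" unfolding B_def by measurable
    then have B: "B \<in> sigma_sets (space M) ?G" by (simp only: past_sets)
    have BM: "B \<in> sets M" using \<open>B \<in> sets I.past\<close> I.sets_past_le I.sets_F by blast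
    have AM: "A \<in> sets M" using A \<alpha>M by blast
    have "\<exists>D\<in>\<Union>n. cell_algebra \<alpha> n. measure M ((B - D) \<union> (D - B)) < \<epsilon>"
    proof (rule sigma_sets_approximation[OF _ _ _ cell_algebra_algebra[OF \<alpha>] B \<epsilon>])
      show "?G \<subseteq> (\<Union>n. cell_algebra \<alpha> n)" using past_cylinders_cell_algebra[OF \<alpha>] by blast
      show "(\<Union>n. cell_algebra \<alpha> n) \<subseteq> sets M" by (auto simp: cell_algebra_def)
    qed unfold_locales
    then obtain D where D: "D \<in> (\<Union>n. cell_algebra \<alpha> n)" "measure M ((B - D) \<union> (D - B)) < \<epsilon>" by blast
    have DM: "D \<in> sets M" using D(1) by (auto simp: cell_algebra_def)
    have "AE x in M. x \<in> A \<longleftrightarrow> x \<in> B"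
      using det[OF A] AE_space by eventually_elim (auto simp: B_def I.past_def split: split_indicator_asm)
    then have "AE x in M. x \<in> (A - D) \<union> (D - A) \<longleftrightarrow> x \<in> (B - D) \<union> (D - B)"
      by eventually_elim blast
    then have "measure M ((A - D) \<union> (D - A)) = measure M ((B - D) \<union> (D - B))"
      using AM BM DM by (intro measure_eq_AE) auto
    then show ?thesis using D by (intro bexI[of _ D]) auto
  qed
  have "(\<lambda>n. partition_entropy M (refined_partition M \<phi> \<alpha> n) / real n) \<longlonglongrightarrow> 0"
  proof (rule Cesaro_zero[OF partition_entropy_nonneg])
    fix \<epsilon> :: real assume \<epsilon>: "\<epsilon> > 0"
    \<comment> \<open>Chosen so that \<open>card \<alpha> * (2 * \<delta>) \<le> \<epsilon>\<close>;
      adding 1 keeps the denominator positive.\<close>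
    define \<delta> where "\<delta> = \<epsilon> / (2 * (real (card \<alpha>) + 1))"
    have \<delta>: "\<delta> > 0" using \<epsilon> by (simp add: \<delta>_def)
    have "\<forall>A\<in>\<alpha>. \<exists>n. \<exists>D\<in>cell_algebra \<alpha> n. measure M ((A - D) \<union> (D - A)) \<le> \<delta>\<^sup>2"
      using approx[of _ "\<delta>\<^sup>2"] \<delta> by fastforce
    from bchoice[OF this] obtain N where N: "\<And>A. A \<in> \<alpha> \<Longrightarrow>
        \<exists>D\<in>cell_algebra \<alpha> (N A). measure M ((A - D) \<union> (D - A)) \<le> \<delta>\<^sup>2" by auto
    \<comment> \<open>One depth for all cells: the sum dominates every \<open>N A\<close>.\<close>
    define K where "K = (\<Sum>A\<in>\<alpha>. N A)"
    have "partition_entropy M (refined_partition M \<phi> \<alpha> (Suc n)) - partition_entropy M (refined_partition M \<phi> \<alpha> n) \<le> \<epsilon>"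
      if "n \<ge> K" for n
    proof -
      let ?Q = "partition_vimage M \<phi> (refined_partition M \<phi> \<alpha> n)"
      have Q: "cell_partition M ?Q"
        by (rule cell_partition_vimage[OF cell_partition_refined[OF \<alpha>] measurable_map])
      have "\<exists>D\<in>sets M. (\<forall>C\<in>?Q. C \<subseteq> D \<or> C \<inter> D = {}) \<and> measure M ((A - D) \<union> (D - A)) \<le> \<delta>\<^sup>2"
        if A: "A \<in> \<alpha>" for A
      proof -
        have "N A \<le> n" using \<open>n \<ge> K\<close> member_le_sum[OF A, of N] fin by (simp add: K_def)
        then have "cell_algebra \<alpha> (N A) \<subseteq> cell_algebra \<alpha> n" by (rule cell_algebra_mono)
        moreover obtain D where "D \<in> cell_algebra \<alpha> (N A)" "measure M ((A - D) \<union> (D - A)) \<le> \<delta>\<^sup>2"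
          using N[OF A] by (elim bexE)
        ultimately show ?thesis by (intro bexI[of _ D]) (auto simp: cell_algebra_def)
      qed
      from conditional_entropy_le[OF \<alpha> Q \<delta> this]
      have "partition_entropy M (refined_partition M \<phi> \<alpha> (Suc n)) - partition_entropy M ?Q \<le> card \<alpha> * (2 * \<delta>)"
        by (simp only: refined_partition_Suc_past[OF \<alpha>])
      moreover have "partition_entropy M ?Q = partition_entropy M (refined_partition M \<phi> \<alpha> n)"
        by (rule partition_entropy_vimage[OF cell_partition_refined[OF \<alpha>]])
      moreover have "card \<alpha> * (2 * \<delta>) \<le> \<epsilon>" using \<epsilon> by (simp add: \<delta>_def field_simps)
      ultimately show ?thesis by simp
    qed
    then show "\<exists>N. \<forall>n\<ge>N. partition_entropy M (refined_partition M \<phi> \<alpha> (Suc n)) -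
        partition_entropy M (refined_partition M \<phi> \<alpha> n) \<le> \<epsilon>" by blast
  qed
  then show ?thesis unfolding entropy_of_partition_def by (rule limI)
qed

end

theorem theorem4p9:
  fixes M :: "'a measure" and \<phi> :: "'a \<Rightarrow> 'a"
  assumes "invertible_measure_preserving_system M \<phi>"
    and "measure_entropy M \<phi> > 0"
  shows "apr_entropy (L2 M :: (real, ('a \<Rightarrow> real) set) normed_module) (koopman M \<phi>) = \<infinity> \<and>
    apr_entropy (L2 M :: (complex, ('a \<Rightarrow> complex) set) normed_module) (koopman M \<phi>) = \<infinity>"
proof -
  interpret invertible_measure_preserving_system M \<phi> by (rule assms(1))
  obtain \<alpha> where \<alpha>: "measurable_partition M \<alpha>" "0 < entropy_of_partition M \<phi> \<alpha>"
    using assms(2) unfolding measure_entropy_def less_SUP_iff by auto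
  note cells = measurable_partition_cell_partition[OF \<alpha>(1)]
  interpret I: invariant_subalgebra M \<phi> "sigma (space M) (cylinders \<alpha>)"
    by (rule invariant_subalgebra_cylinders[OF cells])
  \<comment> \<open>If every cell were determined by its past, the entropy of \<alpha> would
    vanish.\<close>
  obtain A where A: "A \<in> \<alpha>" "\<not> (AE x in M. indicator A x = real_cond_exp M I.past (indicator A) x)"
    using entropy_of_partition_eq_0[OF cells] \<alpha>(2) by fastforce
  have "A \<subseteq> space M" using A(1) cells by (auto simp: cell_partition_def)
  then have "A = (\<phi> ^^ 0) -` A \<inter> space M" by auto
  then have "A \<in> cylinders \<alpha>" using A(1) unfolding cylinders_def by blast
  moreover have "cylinders \<alpha> \<subseteq> Pow (space M)" by (auto simp: cylinders_def)
  ultimately have "A \<in> sets (sigma (space M) (cylinders \<alpha>))" by (simp add: sets_measure_of sigma_sets.Basic)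
  \<comment> \<open>The families are real-valued, so one construction serves both scalar
    fields.\<close>
  note orth = I.orthonormal_innovation_orbits[OF this A(2)]
  show ?thesis
    using apr_entropy_infinite[where 'k = real, OF orth] apr_entropy_infinite[where 'k = complex, OF orth] by simp
qed

end
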